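(* Fix a constant $c>0$. There is a randomized algorithm that, given an $n$-vertex graph $G$ with linear neighborhood complexity (that is, $\eta_G(m)\le c\,m$ for all $m$) and adjacency matrix $M\in\{0,1\}^{n\times n}$, and another arbitrary matrix $P\in\mathbb{R}^{n\times n}$, computes the product $MP$ in time $O(n^2\log^2 n)$ (the implied constant depends only on $c$).
   Context: Graphs are finite, simple and undirected. $N(v)$ denotes the set of neighbors of a vertex $v$. The neighborhood complexity of a graph $G$ is the function $$\eta_G(m)=\max_{C\subseteq V(G),\,|C|=m}\ \bigl|\{N(v)\cap C: v\in V(G)\}\bigr|,\qquad 1\le m\le |V(G)|.$$ Running times are in the standard unit-cost RAM model, with arithmetic operations on real numbers having unit cost. For randomized algorithms, the stated guarantees hold with high probability, i.e. with probability tending to $1$ as $n\to\infty$. *)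

theory Defs
  imports
    "HOL-Probability.Probability"
    "HOL-Library.Landau_Symbols"
    "HOL-Library.Log_Nat"
    "Jordan_Normal_Form.Matrix"
begin

definition simple_graph :: "'a set \<Rightarrow> ('a \<Rightarrow> 'a \<Rightarrow> bool) \<Rightarrow> bool" where
  "simple_graph V E \<longleftrightarrow> finite V \<and>
     (\<forall>u v. E u v \<longrightarrow> u \<in> V \<and> v \<in> V \<and> u \<noteq> v \<and> E v u)"

definition nbhd :: "'a set \<Rightarrow> ('a \<Rightarrow> 'a \<Rightarrow> bool) \<Rightarrow> 'a \<Rightarrow> 'a set" where
  "nbhd V E v = {u \<in> V. E v u}"

text \<open>Meaningful for \<open>1 \<le> m \<le> card V\<close> only; for \<open>m > card V\<close> the maximum ranges over the
  empty set.\<close>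

definition nbhd_complexity :: "'a set \<Rightarrow> ('a \<Rightarrow> 'a \<Rightarrow> bool) \<Rightarrow> nat \<Rightarrow> nat" where
  "nbhd_complexity V E m =
     Max ((\<lambda>C. card ((\<lambda>v. nbhd V E v \<inter> C) ` V)) ` {C. C \<subseteq> V \<and> card C = m})"

definition linear_nbhd_complexity :: "real \<Rightarrow> 'a set \<Rightarrow> ('a \<Rightarrow> 'a \<Rightarrow> bool) \<Rightarrow> bool" where
  "linear_nbhd_complexity c V E \<longleftrightarrow>
     (\<forall>m\<in>{1..card V}. real (nbhd_complexity V E m) \<le> c * real m)"

definition adjacency_matrix :: "nat \<Rightarrow> (nat \<Rightarrow> nat \<Rightarrow> bool) \<Rightarrow> 'b::zero_neq_one mat" where
  "adjacency_matrix n E = mat n n (\<lambda>(i, j). if E i j then 1 else 0)"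

text \<open>
  A randomized unit-cost random access machine. It has registers and a random access memory for
  words, and separately registers and a random access memory for real numbers; both memories are addressed by words. Every instruction
  takes one unit of time. Words are natural numbers below \<open>2 ^ w\<close>, and word arithmetic is modulo
  \<open>2 ^ w\<close>. The word length \<open>w\<close> will be logarithmic in the input size, so that unit-cost word
  operations cannot be abused for computing with huge integers. Real arithmetic is exact and has
  unit cost. There is no rounding instruction: reals influence words only through comparisons.
\<close>

type_synonym reg = nat
type_synonym label = nat

datatype word_op = WAdd | WSub | WMul | WDiv | WMod
datatype real_op = RAdd | RSub | RMul | RDiv

text \<open>The first register of an instruction is its destination, except for the store instructions,
  whose first register holds the address, and for the conditional jumps.\<close>

datatype instr =
    WConst reg nat
  | WMove reg reg
  | WOp word_op reg reg reg
  | WLoad reg reg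
  | WStore reg reg
  | RFromWord reg reg
  | RMove reg reg
  | ROp real_op reg reg reg
  | RLoad reg reg
  | RStore reg reg
  | Random reg reg
  | Jump label
  | JumpWLess reg reg label
  | JumpRLess reg reg label

type_synonym program = "instr list"

record config =
  pc :: nat
  wreg :: "reg \<Rightarrow> nat"
  rreg :: "reg \<Rightarrow> real"
  wmem :: "nat \<Rightarrow> nat"
  rmem :: "nat \<Rightarrow> real"

text \<open>Division by zero yields zero, for words and for reals.\<close>

fun eval_wop :: "nat \<Rightarrow> word_op \<Rightarrow> nat \<Rightarrow> nat \<Rightarrow> nat" where
  "eval_wop w WAdd a b = (a + b) mod 2 ^ w"
| "eval_wop w WSub a b = nat ((int a - int b) mod 2 ^ w)"
| "eval_wop w WMul a b = (a * b) mod 2 ^ w"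
| "eval_wop w WDiv a b = (a div b) mod 2 ^ w"
| "eval_wop w WMod a b = (a mod b) mod 2 ^ w"

fun eval_rop :: "real_op \<Rightarrow> real \<Rightarrow> real \<Rightarrow> real" where
  "eval_rop RAdd x y = x + y"
| "eval_rop RSub x y = x - y"
| "eval_rop RMul x y = x * y"
| "eval_rop RDiv x y = x / y"

definition set_wreg :: "reg \<Rightarrow> nat \<Rightarrow> config \<Rightarrow> config" where
  "set_wreg d x s = s\<lparr>pc := Suc (pc s), wreg := (wreg s)(d := x)\<rparr>"

definition set_rreg :: "reg \<Rightarrow> real \<Rightarrow> config \<Rightarrow> config" where
  "set_rreg d x s = s\<lparr>pc := Suc (pc s), rreg := (rreg s)(d := x)\<rparr>"

definition cond_jump :: "bool \<Rightarrow> label \<Rightarrow> config \<Rightarrow> config" where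
  "cond_jump b l s = s\<lparr>pc := (if b then l else Suc (pc s))\<rparr>"

text \<open>\<open>Random d a\<close> draws a word uniformly at random from \<open>{..<x}\<close>, where \<open>x\<close> is the content of
  register \<open>a\<close>; it yields zero if \<open>x = 0\<close>.\<close>

fun exec_instr :: "nat \<Rightarrow> instr \<Rightarrow> config \<Rightarrow> config pmf" where
  "exec_instr w (WConst d k) s = return_pmf (set_wreg d (k mod 2 ^ w) s)"
| "exec_instr w (WMove d a) s = return_pmf (set_wreg d (wreg s a) s)"
| "exec_instr w (WOp f d a b) s =
     return_pmf (set_wreg d (eval_wop w f (wreg s a) (wreg s b)) s)"
| "exec_instr w (WLoad d a) s = return_pmf (set_wreg d (wmem s (wreg s a)) s)"
| "exec_instr w (WStore a b) s =
     return_pmf (s\<lparr>pc := Suc (pc s), wmem := (wmem s)(wreg s a := wreg s b)\<rparr>)"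
| "exec_instr w (RFromWord d a) s = return_pmf (set_rreg d (real (wreg s a)) s)"
| "exec_instr w (RMove d a) s = return_pmf (set_rreg d (rreg s a) s)"
| "exec_instr w (ROp f d a b) s =
     return_pmf (set_rreg d (eval_rop f (rreg s a) (rreg s b)) s)"
| "exec_instr w (RLoad d a) s = return_pmf (set_rreg d (rmem s (wreg s a)) s)"
| "exec_instr w (RStore a b) s =
     return_pmf (s\<lparr>pc := Suc (pc s), rmem := (rmem s)(wreg s a := rreg s b)\<rparr>)"
| "exec_instr w (Random d a) s =
     (if wreg s a = 0 then return_pmf (set_wreg d 0 s)
      else map_pmf (\<lambda>x. set_wreg d x s) (pmf_of_set {..<wreg s a}))"
| "exec_instr w (Jump l) s = return_pmf (cond_jump True l s)"
| "exec_instr w (JumpWLess a b l) s = return_pmf (cond_jump (wreg s a < wreg s b) l s)"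
| "exec_instr w (JumpRLess a b l) s = return_pmf (cond_jump (rreg s a < rreg s b) l s)"

definition halted :: "program \<Rightarrow> config \<Rightarrow> bool" where
  "halted prog s \<longleftrightarrow> pc s \<ge> length prog"

definition step :: "nat \<Rightarrow> program \<Rightarrow> config \<Rightarrow> config pmf" where
  "step w prog s = (if halted prog s then return_pmf s else exec_instr w (prog ! pc s) s)"

text \<open>The distribution of the configuration after \<open>t\<close> units of time. As halted configurations
  are left unchanged, a configuration in its support is halted iff the corresponding computation
  has halted within \<open>t\<close> units of time.\<close>

primrec run :: "nat \<Rightarrow> program \<Rightarrow> nat \<Rightarrow> config \<Rightarrow> config pmf" where
  "run w prog 0 s = return_pmf s"
| "run w prog (Suc t) s = bind_pmf (step w prog s) (run w prog t)"

text \<open>\<open>floorlog 2 n\<close> is the number of binary digits of \<open>n\<close>.\<close>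

definition word_length :: "nat \<Rightarrow> nat \<Rightarrow> nat" where
  "word_length k n = k * floorlog 2 n"

definition row_major :: "'b::zero mat \<Rightarrow> nat \<Rightarrow> 'b" where
  "row_major A a =
     (if a < dim_row A * dim_col A then A $$ (a div dim_col A, a mod dim_col A) else 0)"

text \<open>Initially, word register \<open>0\<close> holds \<open>n\<close>, the 0/1-matrix is in the word memory and the real
  matrix is in the real memory, both in row-major order starting at address \<open>0\<close>. The result is
  read off the real memory in the same format.\<close>

definition init_config :: "nat \<Rightarrow> nat mat \<Rightarrow> real mat \<Rightarrow> config" where
  "init_config n M P =
     \<lparr>pc = 0, wreg = (\<lambda>_. 0)(0 := n), rreg = (\<lambda>_. 0), wmem = row_major M, rmem = row_major P\<rparr>"

definition output_matrix :: "nat \<Rightarrow> config \<Rightarrow> real mat" where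
  "output_matrix n s = mat n n (\<lambda>(i, j). rmem s (i * n + j))"

end

theory Submission
  imports Defs "HOL-Real_Asymp.Real_Asymp"
begin

text \<open>
  The rows of the product \<open>M * P\<close> are computed one after the other, in an order in which
  consecutive rows of \<open>M\<close> differ in few places. If two rows of \<open>M\<close> differ in \<open>d\<close> entries,
  then one row of the product results from the other by adding or subtracting \<open>d\<close> rows of
  \<open>P\<close>, in time \<open>O(d * n)\<close>. So an order whose consecutive Hamming distances sum to
  \<open>O(n log\<^sup>2 n)\<close> is enough, provided that it is found in time \<open>O(n\<^sup>2 log\<^sup>2 n)\<close>.

  Such an order is obtained by drawing \<open>n\<close> columns independently at random and sorting the rows
  lexicographically by their entries in these columns. Radix sort does this in time \<open>O(n\<^sup>2)\<close>.
  The reason why the order is good is the interplay of two facts about the first \<open>m\<close> draws, which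
  hold for all \<open>m\<close> at once:

  \<^item> With high probability, two rows that agree in the first \<open>m\<close> sampled columns differ in
    only \<open>O(n log n / m)\<close> places, since a large difference set would have been hit
    (\<open>prob_separating\<close>).

  \<^item> By linear neighbourhood complexity the rows have at most \<open>c * m\<close> distinct restrictions to
    these columns. In lexicographic order equal restrictions are contiguous, so at most
    \<open>c * m\<close> consecutive pairs disagree there (\<open>card_changes_radix_sort\<close>).

  A pair whose first disagreement is at draw \<open>f + 1\<close> thus costs \<open>O(n log n / f)\<close>, and few pairs
  have a small \<open>f\<close>. Summation by parts gives a harmonic sum, hence the total
  \<open>O(n log\<^sup>2 n)\<close> (\<open>path_length_radix_sort\<close>). The result is correct for all samples; only the
  running time depends on them.

  On the machine, all random draws precede the other work. The draws give a product distribution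
  on the sampled sequences (\<open>run_draws\<close>); the remaining program is deterministic and is verified by
  a Hoare logic with running times, whose only control structure is the counting loop.
\<close>

section \<open>Timed Hoare logic for relocatable code\<close>

lemma run_add: "run w prog (t + t') s = bind_pmf (run w prog t s) (run w prog t')"
proof (induction t arbitrary: s)
  case (Suc t)
  then have "run w prog (t + t') = (\<lambda>s. bind_pmf (run w prog t s) (run w prog t'))"
    by blast
  then show ?case by (simp add: bind_assoc_pmf)
qed (simp add: bind_return_pmf)

text \<open>Halted configurations are fixed, so a bound on the running time suffices to know the state
  after exactly that many steps.\<close>

lemma run_halted: "halted prog s \<Longrightarrow> run w prog t s = return_pmf s"
  by (induction t) (simp_all add: step_def bind_return_pmf)

lemma run_Suc_return:
  assumes "prog ! pc s = i" "pc s < length prog" "exec_instr w i s = return_pmf s'"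
  shows "run w prog (Suc t) s = run w prog t s'"
  using assms by (simp add: step_def halted_def bind_return_pmf)

lemma run_trans:
  "run w prog t s = return_pmf s' \<Longrightarrow> run w prog t' s' = D \<Longrightarrow> run w prog (t + t') s = D"
  by (simp add: run_add bind_return_pmf)

fun straight :: "instr \<Rightarrow> bool" where
  "straight (Random d a) = False"
| "straight (Jump l) = False"
| "straight (JumpWLess a b l) = False"
| "straight (JumpRLess a b l) = False"
| "straight _ = True"

text \<open>The effect of an instruction on everything but the program counter. Keeping the program counter
  out of this function, and out of all assertions below, makes invariants independent of the place
  at which code is loaded. On \<open>Random\<close> the value is a dummy, excluded by \<open>straight\<close>.\<close>

fun effect :: "nat \<Rightarrow> instr \<Rightarrow> config \<Rightarrow> config" where
  "effect w (WConst d k) s = s\<lparr>wreg := (wreg s)(d := k mod 2 ^ w)\<rparr>"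
| "effect w (WMove d a) s = s\<lparr>wreg := (wreg s)(d := wreg s a)\<rparr>"
| "effect w (WOp f d a b) s = s\<lparr>wreg := (wreg s)(d := eval_wop w f (wreg s a) (wreg s b))\<rparr>"
| "effect w (WLoad d a) s = s\<lparr>wreg := (wreg s)(d := wmem s (wreg s a))\<rparr>"
| "effect w (WStore a b) s = s\<lparr>wmem := (wmem s)(wreg s a := wreg s b)\<rparr>"
| "effect w (RFromWord d a) s = s\<lparr>rreg := (rreg s)(d := real (wreg s a))\<rparr>"
| "effect w (RMove d a) s = s\<lparr>rreg := (rreg s)(d := rreg s a)\<rparr>"
| "effect w (ROp f d a b) s = s\<lparr>rreg := (rreg s)(d := eval_rop f (rreg s a) (rreg s b))\<rparr>"
| "effect w (RLoad d a) s = s\<lparr>rreg := (rreg s)(d := rmem s (wreg s a))\<rparr>"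
| "effect w (RStore a b) s = s\<lparr>rmem := (rmem s)(wreg s a := rreg s b)\<rparr>"
| "effect w _ s = s"

lemma exec_straight:
  "straight i \<Longrightarrow>
    exec_instr w i (s\<lparr>pc := a\<rparr>) = return_pmf ((effect w i s)\<lparr>pc := Suc a\<rparr>)"
  by (cases i) (simp_all add: set_wreg_def set_rreg_def)

text \<open>Jumps are absolute, so a piece of code is a function of the address at which it is placed.\<close>

type_synonym code = "nat \<Rightarrow> instr list"

text \<open>Started at its first instruction, in any surrounding program, \<open>c\<close> takes exactly \<open>t\<close> steps to
  the first address behind it. The result is a point mass: only draw-free code is described.\<close>

definition computes :: "nat \<Rightarrow> code \<Rightarrow> config \<Rightarrow> nat \<Rightarrow> config \<Rightarrow> bool" where
  "computes w c s t s' \<longleftrightarrow> (\<forall>pre post.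
     run w (pre @ c (length pre) @ post) t (s\<lparr>pc := length pre\<rparr>) =
     return_pmf (s'\<lparr>pc := length pre + length (c (length pre))\<rparr>))"

text \<open>Total correctness together with a time bound \<open>T\<close>, which is allowed to depend on the logical
  variables of \<open>P\<close>; this is how a running time that depends on the data is expressed.\<close>

definition hoare ::
  "nat \<Rightarrow> (config \<Rightarrow> bool) \<Rightarrow> code \<Rightarrow> nat \<Rightarrow> (config \<Rightarrow> bool) \<Rightarrow> bool" where
  "hoare w P c T Q \<longleftrightarrow> (\<forall>s. P s \<longrightarrow> (\<exists>t s'. t \<le> T \<and> computes w c s t s' \<and> Q s'))"

definition block :: "instr list \<Rightarrow> code" where
  "block is = (\<lambda>a. is)"

definition seq :: "code \<Rightarrow> code \<Rightarrow> code"  (infixr ";;" 60) where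
  "c ;; d = (\<lambda>a. c a @ d (a + length (c a)))"

text \<open>The test stands behind the body and the loop is entered through it, so an iteration costs three instructions on top of its body.
  Register \<open>1\<close> is scratch: it holds the increment.\<close>

definition for_loop :: "reg \<Rightarrow> reg \<Rightarrow> code \<Rightarrow> code" where
  "for_loop r l c = (\<lambda>a.
     [WConst r 0, Jump (a + 4 + length (c (a + 2)))] @ c (a + 2) @
     [WConst 1 1, WOp WAdd r r 1, JumpWLess r l (a + 2)])"

lemma computes_block:
  "list_all straight is \<Longrightarrow> computes w (block is) s (length is) (fold (effect w) is s)"
proof (induction "is" arbitrary: s)
  case Nil
  then show ?case by (simp add: computes_def block_def)
next
  case (Cons i "is")
  show ?case
    unfolding computes_def
  proof (intro allI)
    fix pre post
    have "run w (pre @ (i # is) @ post) (Suc (length is)) (s\<lparr>pc := length pre\<rparr>) =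
      run w ((pre @ [i]) @ is @ post) (length is) ((effect w i s)\<lparr>pc := length (pre @ [i])\<rparr>)"
      using Cons.prems by (subst run_Suc_return[of _ _ i, OF _ _ exec_straight]) simp_all
    also have "\<dots> = return_pmf ((fold (effect w) (i # is) s)\<lparr>pc := length pre + length (i # is)\<rparr>)"
      using Cons.prems
        Cons.IH[of "effect w i s", unfolded computes_def block_def, rule_format, of "pre @ [i]" post]
      by simp
    finally show "run w (pre @ block (i # is) (length pre) @ post) (length (i # is)) (s\<lparr>pc := length pre\<rparr>) =
      return_pmf ((fold (effect w) (i # is) s)\<lparr>pc := length pre + length (block (i # is) (length pre))\<rparr>)"
      by (simp add: block_def)
  qed
qed

lemma hoare_block:
  assumes "list_all straight is" "length is \<le> T"
    and "\<And>s. P s \<Longrightarrow> Q (fold (effect w) is s)"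
  shows "hoare w P (block is) T Q"
  unfolding hoare_def using assms computes_block by blast

lemma computes_seq:
  assumes "computes w c s t s'" "computes w d s' t' s''"
  shows "computes w (c ;; d) s (t + t') s''"
  unfolding computes_def
proof (intro allI)
  fix pre post :: "instr list"
  let ?C = "c (length pre)" and ?D = "d (length pre + length (c (length pre)))"
  have "run w (pre @ ?C @ ?D @ post) t (s\<lparr>pc := length pre\<rparr>) =
      return_pmf (s'\<lparr>pc := length (pre @ ?C)\<rparr>)"
    using assms(1) unfolding computes_def by simp
  moreover have "run w (pre @ ?C @ ?D @ post) t' (s'\<lparr>pc := length (pre @ ?C)\<rparr>) =
      return_pmf (s''\<lparr>pc := length pre + length (?C @ ?D)\<rparr>)"
    using assms(2)[unfolded computes_def, rule_format, of "pre @ ?C" post] by (simp add: add.assoc)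
  ultimately show "run w (pre @ (c ;; d) (length pre) @ post) (t + t') (s\<lparr>pc := length pre\<rparr>) =
      return_pmf (s''\<lparr>pc := length pre + length ((c ;; d) (length pre))\<rparr>)"
    by (simp add: seq_def run_trans)
qed

lemma hoare_seq:
  assumes "hoare w P c T R" "hoare w R d T' Q" "T + T' \<le> T''"
  shows "hoare w P (c ;; d) T'' Q"
  unfolding hoare_def
proof (intro allI impI)
  fix s assume "P s"
  then obtain t s' where 1: "t \<le> T" "computes w c s t s'" "R s'"
    using assms(1) unfolding hoare_def by blast
  then obtain t' s'' where 2: "t' \<le> T'" "computes w d s' t' s''" "Q s''"
    using assms(2) unfolding hoare_def by blast
  have "t + t' \<le> T''" using 1 2 assms(3) by linarith
  then show "\<exists>t s'. t \<le> T'' \<and> computes w (c ;; d) s t s' \<and> Q s'"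
    using computes_seq[OF 1(2) 2(2)] 2(3) by blast
qed

lemma hoare_conseq:
  assumes "hoare w P c T Q" "\<And>s. P' s \<Longrightarrow> P s" "\<And>s. Q s \<Longrightarrow> Q' s" "T \<le> T'"
  shows "hoare w P' c T' Q'"
  using assms unfolding hoare_def by (meson order_trans)

text \<open>The counter never exceeds the limit \<open>N\<close>, so its increment does not wrap around. The body has to
  establish the invariant for the state after the increment, in which the scratch register has
  changed as well.\<close>

lemma hoare_for:
  assumes N: "N < 2 ^ w"
    and regs: "r \<noteq> 1" "l \<noteq> 1" "r \<noteq> l"
    and init: "\<And>s. P s \<Longrightarrow> wreg s l = N \<and> I 0 (s\<lparr>wreg := (wreg s)(r := 0)\<rparr>)"
    and body: "\<And>i. i < N \<Longrightarrow> hoare w (\<lambda>s. I i s \<and> wreg s r = i \<and> wreg s l = N) c (T i)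
        (\<lambda>s. wreg s r = i \<and> wreg s l = N \<and> I (Suc i) (s\<lparr>wreg := (wreg s)(1 := 1, r := Suc i)\<rparr>))"
    and time: "(\<Sum>i<N. T i + 3) + 3 \<le> T'"
    and post: "\<And>s. I N s \<Longrightarrow> Q s"
  shows "hoare w P (for_loop r l c) T' Q"
proof -
  have w: "1 mod 2 ^ w = (1 :: nat)" if "i < N" for i
    using N that by (cases w) auto
  let ?prog = "\<lambda>pre post. pre @ for_loop r l c (length pre) @ post"
  let ?fin = "\<lambda>pre. length pre + length (for_loop r l c (length pre))"
  let ?test = "\<lambda>pre. length pre + 4 + length (c (length pre + 2))"
  have test: "run w (?prog pre post) (Suc t) (s\<lparr>pc := ?test pre\<rparr>) =
      run w (?prog pre post) t (s\<lparr>pc := if wreg s r < wreg s l then length pre + 2 else ?fin pre\<rparr>)"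
    for pre post s t
    by (subst run_Suc_return[where i = "JumpWLess r l (length pre + 2)"])
       (simp_all add: for_loop_def nth_append cond_jump_def eval_nat_numeral)
  have loop: "\<exists>t s'. t \<le> (\<Sum>j\<in>{i..<N}. T j + 3) + 1 \<and> Q s' \<and> (\<forall>pre post.
      run w (?prog pre post) t (s\<lparr>pc := ?test pre\<rparr>) = return_pmf (s'\<lparr>pc := ?fin pre\<rparr>))"
    if "i \<le> N" "I i s" "wreg s r = i" "wreg s l = N" for i s
    using that
  proof (induction "N - i" arbitrary: i s)
    case 0
    then have "i = N" by simp
    then show ?case
      using 0 post[of s] by (intro exI[of _ 1] exI[of _ s]) (simp only: One_nat_def test, simp)
  next
    case (Suc m)
    then have i: "i < N" by simp
    then obtain t s1 where s1: "t \<le> T i" "computes w c s t s1" "wreg s1 r = i" "wreg s1 l = N"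
      "I (Suc i) (s1\<lparr>wreg := (wreg s1)(1 := 1, r := Suc i)\<rparr>)"
      using body[OF i] Suc.prems unfolding hoare_def by blast
    let ?s2 = "s1\<lparr>wreg := (wreg s1)(1 := 1, r := Suc i)\<rparr>"
    obtain t' s' where IH: "t' \<le> (\<Sum>j\<in>{Suc i..<N}. T j + 3) + 1" "Q s'"
      "\<And>pre post. run w (?prog pre post) t' (?s2\<lparr>pc := ?test pre\<rparr>) = return_pmf (s'\<lparr>pc := ?fin pre\<rparr>)"
    proof -
      have "m = N - Suc i" "Suc i \<le> N" "wreg ?s2 r = Suc i" "wreg ?s2 l = N"
        using Suc.hyps(2) i s1(4) regs by auto
      then show ?thesis using that Suc.hyps(1)[of "Suc i" ?s2] s1(5) by blast
    qed
    have iter: "run w (?prog pre post) (1 + (t + (2 + t'))) (s\<lparr>pc := ?test pre\<rparr>) = return_pmf (s'\<lparr>pc := ?fin pre\<rparr>)"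
      for pre post
    proof (rule run_trans)
      show "run w (?prog pre post) 1 (s\<lparr>pc := ?test pre\<rparr>) = return_pmf (s\<lparr>pc := length pre + 2\<rparr>)"
        using Suc.prems i by (simp only: One_nat_def test, simp)
      let ?pre = "pre @ [WConst r 0, Jump (?test pre)]"
      let ?post = "[WConst 1 1, WOp WAdd r r 1, JumpWLess r l (length pre + 2)] @ post"
      have prog: "?prog pre post = ?pre @ c (length ?pre) @ ?post"
        by (simp add: for_loop_def)
      have inc: "run w (?prog pre post) 2 (s1\<lparr>pc := length pre + 2 + length (c (length pre + 2))\<rparr>)
          = return_pmf (?s2\<lparr>pc := ?test pre\<rparr>)"
        using s1(3) N i w[OF i] regs
        by (simp add: numeral_2_eq_2 step_def halted_def for_loop_def nth_append bind_return_pmf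
            set_wreg_def mod_less)
      show "run w (?prog pre post) (t + (2 + t')) (s\<lparr>pc := length pre + 2\<rparr>) = return_pmf (s'\<lparr>pc := ?fin pre\<rparr>)"
        by (rule run_trans[OF _ run_trans[OF inc IH(3)]])
           (use s1(2)[unfolded computes_def, rule_format, of ?pre ?post] in \<open>simp only: prog, simp\<close>)
    qed
    have "1 + (t + (2 + t')) \<le> (\<Sum>j\<in>{i..<N}. T j + 3) + 1"
      using IH(1) s1(1) i by (simp add: sum.atLeast_Suc_lessThan)
    then show ?case using iter IH(2) by blast
  qed
  show ?thesis
    unfolding hoare_def
  proof (intro allI impI)
    fix s assume "P s"
    let ?s = "s\<lparr>wreg := (wreg s)(r := 0)\<rparr>"
    obtain t s' where t: "t \<le> (\<Sum>j\<in>{0..<N}. T j + 3) + 1" "Q s'"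
      "\<And>pre post. run w (?prog pre post) t (?s\<lparr>pc := ?test pre\<rparr>) = return_pmf (s'\<lparr>pc := ?fin pre\<rparr>)"
      using loop[of 0 ?s] init[OF \<open>P s\<close>] regs by auto
    have "run w (?prog pre post) (2 + t) (s\<lparr>pc := length pre\<rparr>) = return_pmf (s'\<lparr>pc := ?fin pre\<rparr>)"
      for pre post
      by (rule run_trans[OF _ t(3)])
        (simp add: numeral_2_eq_2 step_def halted_def for_loop_def nth_append bind_return_pmf
            set_wreg_def cond_jump_def)
    moreover have "2 + t \<le> T'" using t(1) time by (simp add: atLeast0LessThan)
    ultimately show "\<exists>t s'. t \<le> T' \<and> computes w (for_loop r l c) s t s' \<and> Q s'"
      using t(2) unfolding computes_def by blast
  qed
qed


section \<open>Radix sorting the rows by sampled columns\<close>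

text \<open>Least-significant-digit radix sort: each column splits the current list stably. The head of the
  list of columns is processed last and thus is the most significant one.\<close>

fun radix_sort :: "('v \<Rightarrow> 'c \<Rightarrow> bool) \<Rightarrow> 'c list \<Rightarrow> 'v list \<Rightarrow> 'v list" where
  "radix_sort B [] zs = zs"
| "radix_sort B (c # cs) zs =
     filter (\<lambda>v. \<not> B v c) (radix_sort B cs zs) @ filter (\<lambda>v. B v c) (radix_sort B cs zs)"

text \<open>The row \<open>v\<close>, restricted to the listed columns, read as a binary number; comparing keys is
  comparing rows lexicographically.\<close>

fun key :: "('v \<Rightarrow> 'c \<Rightarrow> bool) \<Rightarrow> 'c list \<Rightarrow> 'v \<Rightarrow> nat" where
  "key B [] v = 0"
| "key B (c # cs) v = (if B v c then 2 ^ length cs else 0) + key B cs v"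

lemma key_less: "key B cs v < 2 ^ length cs"
  by (induction cs) auto

lemma key_cong: "(\<And>c. c \<in> set cs \<Longrightarrow> B v c = B' v' c) \<Longrightarrow> key B cs v = key B' cs v'"
  by (induction cs) auto

lemma key_inject: "key B cs u = key B cs v \<Longrightarrow> c \<in> set cs \<Longrightarrow> B u c = B v c"
proof (induction cs)
  case (Cons d cs)
  have "B u d = B v d" "key B cs u = key B cs v"
    using Cons.prems(1) key_less[of B cs u] key_less[of B cs v] by (auto split: if_splits)
  then show ?case using Cons by auto
qed simp

lemma mset_radix_sort: "mset (radix_sort B cs zs) = mset zs"
  by (induction cs) (auto simp flip: multiset_partition)

lemma length_radix_sort: "length (radix_sort B cs zs) = length zs"
  by (metis mset_radix_sort size_mset)

lemma set_radix_sort: "set (radix_sort B cs zs) = set zs"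
  by (metis mset_radix_sort set_mset_mset)

lemma sorted_map_filter: "sorted (map f ys) \<Longrightarrow> sorted (map f (filter p ys))"
  by (induction ys) auto

lemma sorted_map_key_Nil: "sorted (map (key B []) zs)"
  by (induction zs) auto

text \<open>A single sorting run serves all resolutions at once: a list that is lexicographically sorted is
  also sorted by each prefix of the sequence of columns.\<close>

lemma sorted_radix_sort: "sorted (map (key B (take m cs)) (radix_sort B cs zs))"
proof (induction cs arbitrary: m)
  case (Cons c cs)
  show ?case
  proof (cases m)
    case (Suc k)
    let ?ys = "radix_sort B cs zs" and ?ds = "take k cs"
    have s: "sorted (map (key B ?ds) (filter p ?ys))" for p
      by (rule sorted_map_filter[OF Cons.IH])
    have 0: "map (key B (c # ?ds)) (filter (\<lambda>v. \<not> B v c) ?ys) =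
        map (key B ?ds) (filter (\<lambda>v. \<not> B v c) ?ys)"
      by auto
    have 1: "map (key B (c # ?ds)) (filter (\<lambda>v. B v c) ?ys) =
        map ((+) (2 ^ length ?ds)) (map (key B ?ds) (filter (\<lambda>v. B v c) ?ys))"
      by auto
    have "sorted (map ((+) (2 ^ length ?ds)) (map (key B ?ds) (filter (\<lambda>v. B v c) ?ys)))"
      using s by (simp add: sorted_wrt_map)
    then show ?thesis
      unfolding Suc take_Suc_Cons radix_sort.simps map_append sorted_append 0 1
      using s key_less[of B ?ds] by (auto simp: less_imp_le intro: trans_le_add1)
  qed (simp only: take_0 sorted_map_key_Nil)
qed (simp only: take_Nil sorted_map_key_Nil)

text \<open>The entries right after a change are strictly increasing, hence distinct.\<close>

lemma card_changes_sorted: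
  fixes ks :: "'k :: linorder list"
  assumes "sorted ks"
  shows "card {i. Suc i < length ks \<and> ks ! i \<noteq> ks ! Suc i} \<le> card (set ks)"
proof (rule card_inj_on_le)
  let ?I = "{i. Suc i < length ks \<and> ks ! i \<noteq> ks ! Suc i}"
  have "ks ! Suc i < ks ! Suc j" if "i < j" "i \<in> ?I" "j \<in> ?I" for i j
  proof -
    have "ks ! Suc i \<le> ks ! j" "ks ! j \<le> ks ! Suc j"
      using that assms by (auto simp: sorted_iff_nth_mono)
    then show ?thesis using that by auto
  qed
  then show "inj_on (\<lambda>i. ks ! Suc i) ?I"
    by (intro linorder_inj_onI') (auto simp: neq_iff)
qed auto

text \<open>Neighbourhood complexity bounds the number of distinct restrictions of rows to a set of
  columns.\<close>

lemma card_traces_le: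
  fixes n :: nat
  assumes lin: "linear_nbhd_complexity c {..<n} E"
    and C: "C \<subseteq> {..<n}" "C \<noteq> {}"
  shows "real (card ((\<lambda>v. {x \<in> C. E v x}) ` {..<n})) \<le> c * real (card C)"
proof -
  have fin: "finite C" by (rule finite_subset[OF C(1)]) simp
  have card: "card C \<in> {1..card {..<n}}"
    using card_mono[OF _ C(1)] fin C(2) by (simp add: Suc_le_eq card_gt_0_iff)
  have "(\<lambda>v. {x \<in> C. E v x}) ` {..<n} = (\<lambda>v. nbhd {..<n} E v \<inter> C) ` {..<n}"
    using C(1) by (intro image_cong) (auto simp: nbhd_def)
  then have "card ((\<lambda>v. {x \<in> C. E v x}) ` {..<n}) \<le> nbhd_complexity {..<n} E (card C)"
    unfolding nbhd_complexity_def using C(1) by (intro Max_ge) auto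
  then show ?thesis
    using lin card unfolding linear_nbhd_complexity_def by (meson of_nat_mono order_trans)
qed

text \<open>In sorted order, rows with equal restriction to the first \<open>m\<close> sampled columns are contiguous.
  So the number of neighbouring rows that differ there is at most the number of restrictions, which
  is linear in \<open>m\<close>.\<close>

lemma card_changes_radix_sort:
  fixes n :: nat
  assumes lin: "linear_nbhd_complexity c {..<n} E" and "c > 0"
    and cs: "set cs \<subseteq> {..<n}" "cs \<noteq> []" and m: "m \<ge> 1"
  defines "ys \<equiv> radix_sort E cs [0..<n]"
  shows "real (card {i. Suc i < n \<and>
      (\<exists>x\<in>set (take m cs). E (ys ! i) x \<noteq> E (ys ! Suc i) x)}) \<le> c * real m"
proof -
  let ?ds = "take m cs"
  have len: "length ys = n" by (simp add: ys_def length_radix_sort)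
  have "{i. Suc i < n \<and> (\<exists>x\<in>set ?ds. E (ys ! i) x \<noteq> E (ys ! Suc i) x)} \<subseteq>
      {i. Suc i < length (map (key E ?ds) ys) \<and>
         map (key E ?ds) ys ! i \<noteq> map (key E ?ds) ys ! Suc i}" (is "?D \<subseteq> ?K")
    using key_inject len by fastforce
  then have "card ?D \<le> card ?K"
    by (rule card_mono[rotated]) (rule finite_subset[of _ "{..<n}"], auto simp: len)
  also have "card ?K \<le> card (set (map (key E ?ds) ys))"
    unfolding ys_def by (intro card_changes_sorted sorted_radix_sort)
  also have "set (map (key E ?ds) ys) =
      (\<lambda>S. key (\<lambda>S x. x \<in> S) ?ds S) ` (\<lambda>v. {x \<in> set ?ds. E v x}) ` {..<n}"
    unfolding image_image set_map ys_def set_radix_sort set_upt atLeast0LessThan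
    by (intro image_cong refl key_cong) auto
  also have "card \<dots> \<le> card ((\<lambda>v. {x \<in> set ?ds. E v x}) ` {..<n})"
    by (intro card_image_le) auto
  finally have "real (card ?D) \<le> real (card ((\<lambda>v. {x \<in> set ?ds. E v x}) ` {..<n}))"
    by simp
  also have "\<dots> \<le> c * real (card (set ?ds))"
    using cs m set_take_subset[of m cs] by (intro card_traces_le[OF lin]) auto
  also have "\<dots> \<le> c * real m"
    using \<open>c > 0\<close> card_length[of ?ds] by (intro mult_left_mono) auto
  finally show ?thesis .
qed

text \<open>Rows that disagree at the first column cost at most \<open>n\<close>. For rows that agree on exactly the first
  \<open>f \<ge> 1\<close> columns the bound is \<open>L / f\<close>. Writing
  \<open>1 / f\<close> as a telescoping sum of \<open>1 / (m * (m - 1))\<close> over \<open>m\<close> from \<open>f + 1\<close> to \<open>n\<close>, plus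
  \<open>1 / n\<close>, turns it into a sum over the \<open>m\<close> on which the rows disagree, to which the count of
  changes at each \<open>m\<close> applies.\<close>

lemma agreement_weight:
  fixes H L :: real
  assumes "n \<ge> 1" "L \<ge> 0" "H \<le> real n"
    and ag: "\<And>m. 1 \<le> m \<Longrightarrow> m \<le> n \<Longrightarrow> ag m \<Longrightarrow> real m * H \<le> L"
  shows "H \<le> real n * of_bool (\<not> ag 1) +
    L * ((\<Sum>m\<in>{2..n}. of_bool (\<not> ag m) / (real m * (real m - 1))) + 1 / real n)"
proof (cases "ag 1")
  case False
  have "0 \<le> L * ((\<Sum>m\<in>{2..n}. of_bool (\<not> ag m) / (real m * (real m - 1))) + 1 / real n)"
    using assms by (intro mult_nonneg_nonneg add_nonneg_nonneg sum_nonneg) auto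
  then show ?thesis using False assms by simp
next
  case True
  have "1 \<le> k \<Longrightarrow> k \<le> n \<Longrightarrow>
      H \<le> L * ((\<Sum>m\<in>{2..k}. of_bool (\<not> ag m) / (real m * (real m - 1))) + 1 / real k)" for k
  proof (induction k)
    case (Suc k)
    show ?case
    proof (cases "k = 0")
      case True
      then show ?thesis using ag[of 1] \<open>ag 1\<close> \<open>n \<ge> 1\<close> by simp
    next
      case False
      then have IH: "H \<le> L * ((\<Sum>m\<in>{2..k}. of_bool (\<not> ag m) / (real m * (real m - 1))) + 1 / real k)"
        using Suc by simp
      show ?thesis
      proof (cases "ag (Suc k)")
        case True
        have "0 \<le> (\<Sum>m\<in>{2..Suc k}. of_bool (\<not> ag m) / (real m * (real m - 1)))"
          by (intro sum_nonneg) auto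
        then have "L * (1 / real (Suc k)) \<le> L * ((\<Sum>m\<in>{2..Suc k}. of_bool (\<not> ag m) / (real m * (real m - 1))) + 1 / real (Suc k))"
          using \<open>L \<ge> 0\<close> by (intro mult_left_mono) auto
        moreover have "H \<le> L * (1 / real (Suc k))"
          using ag[OF _ Suc.prems(2) True] by (simp add: field_simps)
        ultimately show ?thesis by linarith
      next
        case ag: False
        have "1 / ((r + 1) * r) + 1 / (r + 1) = 1 / r" if "r > 0" for r :: real
          using that by (simp add: divide_simps)
        from this[of "real k"] have "(\<Sum>m\<in>{2..Suc k}. of_bool (\<not> ag m) / (real m * (real m - 1))) + 1 / real (Suc k) =
            (\<Sum>m\<in>{2..k}. of_bool (\<not> ag m) / (real m * (real m - 1))) + 1 / real k"
          using False ag by (simp add: add.commute add.left_commute)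
        then show ?thesis using IH by (simp only:)
      qed
    qed
  qed simp
  from this[of n] show ?thesis using True \<open>n \<ge> 1\<close> by simp
qed

lemma harmonic_le: "n \<ge> 1 \<Longrightarrow> (\<Sum>m\<in>{2..n}. 1 / (real m - 1)) \<le> 1 + ln (real n)"
proof -
  assume "n \<ge> 1"
  then obtain k where n: "n = Suc k" by (cases n) auto
  have "(\<Sum>m\<in>{2..n}. 1 / (real m - 1)) = (\<Sum>m\<in>{1..k}. 1 / real m)"
    by (rule sum.reindex_bij_witness[of _ Suc "\<lambda>m. m - 1"]) (auto simp: n)
  also have "\<dots> \<le> harm (Suc k)"
    by (simp add: harm_def inverse_eq_divide)
  also have "harm (Suc k) - ln (real (Suc k)) \<le> (1::real)"
    using decseqD[OF decseq_harm_diff_ln, of 0 k] by (simp add: harm_def)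
  then have "harm (Suc k) \<le> 1 + ln (real n)" by (simp add: n)
  finally show ?thesis .
qed

definition hamming :: "(nat \<Rightarrow> nat \<Rightarrow> bool) \<Rightarrow> nat \<Rightarrow> nat \<Rightarrow> nat \<Rightarrow> nat" where
  "hamming E n u v = card {x. x < n \<and> E u x \<noteq> E v x}"

text \<open>The \<open>\<epsilon>\<close>-net property, for all sample sizes simultaneously: rows that a sample of \<open>m\<close> columns
  does not tell apart have Hamming distance \<open>O(n log n / m)\<close>.\<close>

definition separating :: "(nat \<Rightarrow> nat \<Rightarrow> bool) \<Rightarrow> nat \<Rightarrow> nat list \<Rightarrow> bool" where
  "separating E n cs \<longleftrightarrow> (\<forall>u<n. \<forall>v<n. \<forall>m\<in>{1..n}.
     (\<forall>x\<in>set (take m cs). E u x = E v x) \<longrightarrow>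
     real m * real (hamming E n u v) \<le> 4 * real n * ln (real n))"

text \<open>The row differences along the sorted order sum to \<open>O(n log\<^sup>2 n)\<close>. One logarithm comes
  from the sampling; the other one is the harmonic sum of the number \<open>c * m\<close> of changes at
  resolution \<open>m\<close>, weighted by \<open>1 / (m * (m - 1))\<close>.\<close>

lemma path_length_radix_sort:
  assumes lin: "linear_nbhd_complexity c {..<n} E" and "c > 0" and "n \<ge> 1"
    and cs: "set cs \<subseteq> {..<n}" "length cs = n" and sep: "separating E n cs"
  defines "ys \<equiv> radix_sort E cs [0..<n]"
  shows "real (\<Sum>i<n - 1. hamming E n (ys ! i) (ys ! Suc i)) \<le>
    c * real n + 4 * real n * ln (real n) * (c * (1 + ln (real n)) + 1)"
proof -
  define L where "L = 4 * real n * ln (real n)"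
  have L: "L \<ge> 0" using \<open>n \<ge> 1\<close> by (simp add: L_def)
  have ys: "length ys = n" "set ys = {..<n}"
    by (auto simp: ys_def length_radix_sort set_radix_sort)
  define ag where "ag i m \<longleftrightarrow> (\<forall>x\<in>set (take m cs). E (ys ! i) x = E (ys ! Suc i) x)" for i m
  have changes: "(\<Sum>i<n - 1. of_bool (\<not> ag i m)) \<le> c * real m" if "m \<ge> 1" for m
  proof -
    have "(\<Sum>i<n - 1. of_bool (\<not> ag i m)) = real (card {i. Suc i < n \<and> (\<exists>x\<in>set (take m cs). E (ys ! i) x \<noteq> E (ys ! Suc i) x)})"
      by (simp add: of_bool_def sum.If_cases ag_def Int_def)
        (intro arg_cong[of _ _ card] Collect_cong, auto)
    also have "\<dots> \<le> c * real m"
      unfolding ys_def using \<open>n \<ge> 1\<close> cs that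
      by (intro card_changes_radix_sort[OF lin \<open>c > 0\<close>]) auto
    finally show ?thesis .
  qed
  have "real (hamming E n (ys ! i) (ys ! Suc i)) \<le> real n * of_bool (\<not> ag i 1) +
      L * ((\<Sum>m\<in>{2..n}. of_bool (\<not> ag i m) / (real m * (real m - 1))) + 1 / real n)"
    if "i < n - 1" for i
  proof (rule agreement_weight[OF \<open>n \<ge> 1\<close> L])
    have "hamming E n (ys ! i) (ys ! Suc i) \<le> card {..<n}"
      unfolding hamming_def by (intro card_mono) auto
    then show "real (hamming E n (ys ! i) (ys ! Suc i)) \<le> real n" by simp
    have "ys ! i < n" "ys ! Suc i < n" using that ys nth_mem[of _ ys] by auto
    then show "real m * real (hamming E n (ys ! i) (ys ! Suc i)) \<le> L"
      if "1 \<le> m" "m \<le> n" "ag i m" for m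
      using sep that unfolding separating_def ag_def L_def by auto
  qed
  note weight = this
  have swap: "(\<Sum>i<n - 1. \<Sum>m\<in>{2..n}. of_bool (\<not> ag i m) / (real m * (real m - 1))) =
      (\<Sum>m\<in>{2..n}. (\<Sum>i<n - 1. of_bool (\<not> ag i m)) / (real m * (real m - 1)))"
    by (subst sum.swap) (simp only: sum_divide_distrib)
  have "real (\<Sum>i<n - 1. hamming E n (ys ! i) (ys ! Suc i)) \<le>
      (\<Sum>i<n - 1. real n * of_bool (\<not> ag i 1) +
        L * ((\<Sum>m\<in>{2..n}. of_bool (\<not> ag i m) / (real m * (real m - 1))) + 1 / real n))"
    unfolding of_nat_sum by (intro sum_mono weight) auto
  also have "\<dots> = real n * (\<Sum>i<n - 1. of_bool (\<not> ag i 1)) +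
      L * ((\<Sum>m\<in>{2..n}. (\<Sum>i<n - 1. of_bool (\<not> ag i m)) / (real m * (real m - 1))) + real (n - 1) / real n)"
    by (simp only: sum.distrib sum_distrib_left[symmetric] swap) simp
  \<comment> \<open>The number of changes is bounded separately at every resolution \<open>m\<close>.\<close>
  also have "\<dots> \<le> real n * (c * real 1) +
      L * ((\<Sum>m\<in>{2..n}. c * real m / (real m * (real m - 1))) + 1)"
    using L \<open>n \<ge> 1\<close>
    by (intro add_mono mult_left_mono sum_mono divide_right_mono changes) (auto simp: field_simps)
  also have "(\<Sum>m\<in>{2..n}. c * real m / (real m * (real m - 1))) = c * (\<Sum>m\<in>{2..n}. 1 / (real m - 1))"
    unfolding sum_distrib_left by (intro sum.cong) auto
  also have "real n * (c * real 1) + L * (c * (\<Sum>m\<in>{2..n}. 1 / (real m - 1)) + 1) \<le>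
      real n * (c * real 1) + L * (c * (1 + ln (real n)) + 1)"
    using L \<open>c > 0\<close> harmonic_le[OF \<open>n \<ge> 1\<close>] by (intro add_mono mult_left_mono) auto
  finally show ?thesis by (simp add: L_def mult.commute)
qed

lemma prob_replicate_pmf_take:
  assumes "m \<le> n"
  shows "measure_pmf.prob (replicate_pmf n p) {xs. set (take m xs) \<subseteq> A} = measure_pmf.prob p A ^ m"
  using assms
proof (induction n arbitrary: m)
  case (Suc n)
  show ?case
  proof (cases m)
    case (Suc k)
    have "emeasure (replicate_pmf (Suc n) p) {xs. set (take m xs) \<subseteq> A} =
        (\<integral>\<^sup>+x. \<integral>\<^sup>+xs. indicator A x * indicator {xs. set (take k xs) \<subseteq> A} xs \<partial>replicate_pmf n p \<partial>p)"
      unfolding replicate_pmf.simps Suc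
      by (auto intro!: nn_integral_cong simp: indicator_def)
    also have "\<dots> = emeasure p A * emeasure (replicate_pmf n p) {xs. set (take k xs) \<subseteq> A}"
      by (simp add: nn_integral_cmult nn_integral_multc)
    finally show ?thesis
      using Suc.IH[of k] Suc.prems Suc
      by (simp add: measure_pmf.emeasure_eq_measure flip: ennreal_mult')
  qed simp
qed simp

text \<open>A pair of rows at distance \<open>d\<close> survives \<open>m\<close> draws with probability
  \<open>(1 - d / n) ^ m \<le> exp (- m * d / n)\<close>. The factor \<open>4\<close> in the threshold makes this at most
  \<open>n\<close> to the power \<open>-4\<close>, so a union bound over the at most \<open>n ^ 3\<close> choices of two rows and a
  sample size leaves a failure probability of \<open>1 / n\<close>.\<close>

lemma prob_separating:
  assumes n: "n \<ge> 1"
  shows "measure_pmf.prob (replicate_pmf n (pmf_of_set {..<n})) {cs. separating E n cs} \<ge> 1 - 1 / real n"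
proof -
  have ne: "{..<n} \<noteq> {}" using n by (auto simp: lessThan_empty_iff)
  let ?U = "pmf_of_set {..<n}"
  let ?D = "\<lambda>u v. {x. x < n \<and> E u x \<noteq> E v x}"
  define bad where "bad = (\<lambda>(u, v, m). {cs :: nat list. (\<forall>x\<in>set (take m cs). E u x = E v x) \<and>
     real m * real (hamming E n u v) > 4 * real n * ln (real n)})"
  have bad: "measure_pmf.prob (replicate_pmf n ?U) (bad (u, v, m)) \<le> 1 / real n ^ 4" (is "?p \<le> _")
    if m: "m \<in> {1..n}" for u v m
  proof (cases "real m * real (hamming E n u v) > 4 * real n * ln (real n)")
    case True
    let ?d = "hamming E n u v"
    have d: "?d \<le> n"
      unfolding hamming_def using card_mono[of "{..<n}" "?D u v"] by auto
    have "?p \<le> measure_pmf.prob (replicate_pmf n ?U) {cs. set (take m cs) \<subseteq> {x. E u x = E v x}}"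
      by (intro measure_pmf.finite_measure_mono) (auto simp: bad_def)
    also have "\<dots> = measure_pmf.prob ?U {x. E u x = E v x} ^ m"
      using m by (intro prob_replicate_pmf_take) auto
    also have "measure_pmf.prob ?U {x. E u x = E v x} = real (card ({..<n} - ?D u v)) / real n"
      using ne by (subst measure_pmf_of_set) (auto intro!: arg_cong[of _ _ card])
    also have "\<dots> = 1 - real ?d / real n"
      using n d by (subst card_Diff_subset) (auto simp: hamming_def of_nat_diff diff_divide_distrib)
    also have "(1 - real ?d / real n) ^ m \<le> exp (- (real ?d / real n)) ^ m"
      using d n exp_ge_add_one_self[of "- (real ?d / real n)"] by (intro power_mono) auto
    also have "\<dots> = exp (- (real m * real ?d / real n))"
      by (simp add: exp_of_nat_mult[symmetric])
    also have "\<dots> \<le> exp (- (4 * ln (real n)))"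
      using True n by (simp add: field_simps)
    also have "\<dots> = 1 / real n ^ 4"
      using n exp_of_nat_mult[of 4 "ln (real n)"] by (simp add: exp_minus divide_inverse)
    finally show ?thesis .
  next
    case False
    then have "bad (u, v, m) = {}" by (auto simp: bad_def)
    then show ?thesis by simp
  qed
  have "measure_pmf.prob (replicate_pmf n ?U) (\<Union> (bad ` ({..<n} \<times> {..<n} \<times> {1..n}))) \<le>
      (\<Sum>i\<in>{..<n} \<times> {..<n} \<times> {1..n}. measure_pmf.prob (replicate_pmf n ?U) (bad i))"
    by (intro measure_pmf.finite_measure_subadditive_finite) auto
  also have "\<dots> \<le> (\<Sum>i\<in>{..<n} \<times> {..<n} \<times> {1..n}. 1 / real n ^ 4)"
    using bad by (intro sum_mono) auto
  also have "\<dots> = 1 / real n"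
    using n by (simp add: eval_nat_numeral)
  finally have "measure_pmf.prob (replicate_pmf n ?U) (\<Union> (bad ` ({..<n} \<times> {..<n} \<times> {1..n}))) \<le> 1 / real n" .
  moreover have Un: "cs \<in> \<Union> (bad ` ({..<n} \<times> {..<n} \<times> {1..n})) \<longleftrightarrow>
     (\<exists>u<n. \<exists>v<n. \<exists>m\<in>{1..n}. (\<forall>x\<in>set (take m cs). E u x = E v x) \<and>
       real m * real (hamming E n u v) > 4 * real n * ln (real n))" for cs
    unfolding bad_def by auto
  have "{cs. separating E n cs} = space (replicate_pmf n ?U) - \<Union> (bad ` ({..<n} \<times> {..<n} \<times> {1..n}))"
    unfolding separating_def
    by (intro Set.set_eqI) (simp only: Un Diff_iff mem_Collect_eq space_measure_pmf UNIV_I simp_thms, meson not_le)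
  ultimately show ?thesis
    using measure_pmf.prob_compl[of "\<Union> (bad ` ({..<n} \<times> {..<n} \<times> {1..n}))" "replicate_pmf n ?U"]
    by simp
qed


section \<open>The program\<close>

text \<open>Word memory holds the 0/1-matrix, then from \<open>n\<^sup>2\<close> on the \<open>n\<close> sampled columns, the current
  permutation of the rows (base address in \<open>rPerm\<close>), the 0/1-vector whose product with the real
  matrix is currently available (\<open>rBits\<close>), and a sorting buffer (\<open>rBuf\<close>). The buffer comes last
  because a scan may write one cell beyond it. Real memory holds the input, then from \<open>n\<^sup>2\<close> on
  (\<open>rSq\<close>) the rows of the result, then from \<open>2 * n\<^sup>2\<close> on (\<open>rVec\<close>) the product belonging to the
  vector at \<open>rBits\<close>. The remaining registers hold counters, operands and
  intermediate values.\<close>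

abbreviation (input) rN :: reg where "rN \<equiv> 0"
abbreviation (input) rOne :: reg where "rOne \<equiv> 1"
abbreviation (input) rSq :: reg where "rSq \<equiv> 2"
abbreviation (input) rPerm :: reg where "rPerm \<equiv> 4"
abbreviation (input) rBits :: reg where "rBits \<equiv> 6"
abbreviation (input) rBuf :: reg where "rBuf \<equiv> 7"
abbreviation (input) rVec :: reg where "rVec \<equiv> 9"
abbreviation (input) rI :: reg where "rI \<equiv> 10"
abbreviation (input) rA :: reg where "rA \<equiv> 11"
abbreviation (input) rT :: reg where "rT \<equiv> 12"
abbreviation (input) rX :: reg where "rX \<equiv> 13"
abbreviation (input) rQ :: reg where "rQ \<equiv> 14"
abbreviation (input) rV :: reg where "rV \<equiv> 15"
abbreviation (input) rB :: reg where "rB \<equiv> 16"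
abbreviation (input) rC :: reg where "rC \<equiv> 17"
abbreviation (input) rK :: reg where "rK \<equiv> 18"

definition layout_code :: code where
  "layout_code =
     block [WOp WAdd rBits rPerm rN, WOp WAdd rBuf rBits rN, WOp WAdd rVec rSq rSq] ;;
     for_loop rI rN (block [WOp WAdd rA rPerm rI, WStore rA rI])"

text \<open>Appends to the buffer, in the current order, the rows whose entry in column \<open>rX\<close> differs from
  \<open>flip\<close>. Every row is written to the end of the buffer, but the write pointer advances only if the
  row is to be kept; this avoids branching.\<close>

definition scan_code :: "bool \<Rightarrow> code" where
  "scan_code flip = for_loop rI rN (block
     ([WOp WAdd rA rPerm rI, WLoad rV rA, WOp WMul rB rV rN, WOp WAdd rB rB rX, WLoad rB rB,
       WStore rQ rV] @
      (if flip then [WConst rA 1, WOp WSub rB rA rB] else []) @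
      [WOp WAdd rQ rQ rB]))"

definition copy_code :: code where
  "copy_code = for_loop rI rN
     (block [WOp WAdd rA rBuf rI, WLoad rV rA, WOp WAdd rA rPerm rI, WStore rA rV])"

text \<open>The columns are used from the last to the first, as the first one is to be the most significant.\<close>

definition sort_code :: code where
  "sort_code = for_loop rT rN (
     block [WConst rOne 1, WOp WAdd rA rT rOne, WOp WSub rA rPerm rA, WLoad rX rA, WMove rQ rBuf] ;;
     scan_code True ;; scan_code False ;; copy_code)"

text \<open>Adds \<open>d\<close> times a row of the real matrix, whose base address is in \<open>rC\<close>, to the current product;
  \<open>d\<close> is in real register \<open>0\<close>.\<close>

definition axpy_code :: code where
  "axpy_code = for_loop rK rV (block
     [WOp WAdd rA rC rK, RLoad 1 rA, ROp RMul 1 0 1,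
      WOp WAdd rA rVec rK, RLoad 2 rA, ROp RAdd 2 2 1, RStore rA 2])"

text \<open>Replaces one entry of the current 0/1-vector. The multiplier is the difference \<open>d\<close> of the new and
  the old bit, and the number of iterations of the update loop is \<open>n\<close> times their sum modulo \<open>2\<close>.
  So unchanged entries cost constant time, without a conditional jump.\<close>

definition entry_code :: code where
  "entry_code =
     block [WOp WAdd rA rQ rI, WLoad rV rA, WOp WAdd rB rBits rI, WLoad rC rB, WStore rB rV,
       RFromWord 0 rV, RFromWord 1 rC, ROp RSub 0 0 1,
       WOp WAdd rV rV rC, WConst rB 2, WOp WMod rV rV rB, WOp WMul rV rV rN, WOp WMul rC rI rN] ;;
     axpy_code"

definition store_row_code :: code where
  "store_row_code = for_loop rI rN (block
     [WOp WAdd rA rVec rI, RLoad 1 rA, WOp WAdd rA rSq rQ, WOp WAdd rA rA rI, RStore rA 1])"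

definition rows_code :: code where
  "rows_code = for_loop rT rN (
     block [WOp WAdd rA rPerm rT, WLoad rX rA, WOp WMul rQ rX rN] ;;
     for_loop rI rN entry_code ;; store_row_code)"

definition output_code :: code where
  "output_code = for_loop rI rSq (block [WOp WAdd rA rSq rI, RLoad 1 rA, RStore rI 1])"

text \<open>Word arithmetic agrees with arithmetic on natural numbers as long as nothing wraps around; these
  conditional rules replace the defining equations in symbolic execution.\<close>

lemma eval_add: "(a :: nat) + b < 2 ^ w \<Longrightarrow> eval_wop w WAdd a b = a + b"
  and eval_mul: "a * b < 2 ^ w \<Longrightarrow> eval_wop w WMul a b = a * b"
  and eval_mod2: "2 < (2 :: nat) ^ w \<Longrightarrow> eval_wop w WMod a 2 = a mod 2"
  by (auto intro!: mod_less order_le_less_trans[of "a mod 2" 2 "2 ^ w"])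

lemma eval_sub: "b \<le> a \<Longrightarrow> a < 2 ^ w \<Longrightarrow> eval_wop w WSub a b = a - b"
proof -
  assume "b \<le> a" "a < 2 ^ w"
  then have "int (a - b) < int (2 ^ w)" by (simp only: of_nat_less_iff)
  then have "int (a - b) mod int (2 ^ w) = int (a - b)" by (intro mod_pos_pos_trivial) auto
  then show ?thesis using \<open>b \<le> a\<close> by (simp add: of_nat_diff)
qed

declare eval_wop.simps [simp del]

text \<open>Fixing the initial state allows a postcondition to refer to it.\<close>

lemma hoare_snapshot: "(\<And>s0. P s0 \<Longrightarrow> hoare w (\<lambda>s. s = s0) c T Q) \<Longrightarrow> hoare w P c T Q"
  unfolding hoare_def by simp

lemma hoare_for_block:
  assumes "list_all straight is"
    and "N < 2 ^ w" "r \<noteq> 1" "l \<noteq> 1" "r \<noteq> l"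
    and "\<And>s. P s \<Longrightarrow> wreg s l = N \<and> I 0 (s\<lparr>wreg := (wreg s)(r := 0)\<rparr>)"
    and "\<And>i s. i < N \<Longrightarrow> I i s \<Longrightarrow> wreg s r = i \<Longrightarrow> wreg s l = N \<Longrightarrow>
      wreg (fold (effect w) is s) r = i \<and> wreg (fold (effect w) is s) l = N \<and>
      I (Suc i) ((fold (effect w) is s)\<lparr>wreg := (wreg (fold (effect w) is s))(1 := 1, r := Suc i)\<rparr>)"
    and "\<And>s. I N s \<Longrightarrow> Q s"
    and "N * (length is + 3) + 3 \<le> T"
  shows "hoare w P (for_loop r l (block is)) T Q"
  using assms
  by (intro hoare_for[where I = I and N = N and T = "\<lambda>_. length is"] hoare_block)
    (auto simp: add_mult_distrib2)

definition stored :: "(nat \<Rightarrow> nat) \<Rightarrow> nat \<Rightarrow> nat list \<Rightarrow> bool" where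
  "stored m b ys \<longleftrightarrow> (\<forall>i<length ys. m (b + i) = ys ! i)"

lemma stored_Nil [simp]: "stored m b []"
  by (simp add: stored_def)

lemma stored_snoc: "stored m b ys \<Longrightarrow> a = b + length ys \<Longrightarrow> stored (m(a := v)) b (ys @ [v])"
  by (auto simp: stored_def nth_append less_Suc_eq)

lemma stored_other:
  "stored m b ys \<Longrightarrow> a < b \<or> b + length ys \<le> a \<Longrightarrow> stored (m(a := v)) b ys"
  by (auto simp: stored_def)

text \<open>The variable \<open>N2\<close> stands for \<open>n\<^sup>2\<close>; since it is opaque, linear arithmetic can decide the
  disjointness of memory areas. All addresses in use are below the bound in \<open>small\<close>.\<close>

locale product_machine =
  fixes n w N2 :: nat and E :: "nat \<Rightarrow> nat \<Rightarrow> bool" and M :: "nat \<Rightarrow> nat"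
  assumes n: "n \<ge> 1" and N2: "N2 = n * n" and small: "3 * N2 + 4 * n + 3 < 2 ^ w"
    and M: "\<And>v x. v < n \<Longrightarrow> x < n \<Longrightarrow> M (v * n + x) = of_bool (E v x)"
begin

lemma n_le: "n \<le> N2"
  using n by (simp add: N2)

lemma index_less: "v < n \<Longrightarrow> x < n \<Longrightarrow> v * n + x < N2"
proof -
  assume "v < n" "x < n"
  then have "v * n + x < Suc v * n" by simp
  also have "\<dots> \<le> N2" unfolding N2 using \<open>v < n\<close> by (intro mult_le_mono1) simp
  finally show ?thesis .
qed

lemma row_start_less: "v < n \<Longrightarrow> v * n < N2"
  using n by (simp add: N2)

lemma w_pos: "w > 0"
  using small by (cases w) auto

lemma two_mod: "2 mod 2 ^ w = (2 :: nat)"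
  using small by (intro mod_less) simp

lemma one_mod: "1 mod 2 ^ w = (1 :: nat)"
  using small by (intro mod_less) simp

definition pointers :: "(reg \<Rightarrow> nat) \<Rightarrow> bool" where
  "pointers f \<longleftrightarrow> f rN = n \<and> f rSq = N2 \<and> f rPerm = N2 + n \<and> f rBits = N2 + 2 * n \<and>
     f rBuf = N2 + 3 * n \<and> f rVec = 2 * N2"

definition bits_clear :: "config \<Rightarrow> bool" where
  "bits_clear s \<longleftrightarrow> (\<forall>j<n. wmem s (N2 + 2 * n + j) = 0)"

lemma hoare_layout:
  "hoare w (\<lambda>s. wreg s rN = n \<and> wreg s rSq = N2 \<and> wreg s rPerm = N2 + n \<and>
        (\<forall>a<N2 + n. wmem s a = h a) \<and> (\<forall>a\<ge>N2 + n. wmem s a = 0) \<and> rmem s = g)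
     layout_code (5 * n + 6)
     (\<lambda>s. pointers (wreg s) \<and> stored (wmem s) (N2 + n) [0..<n] \<and>
        (\<forall>a<N2 + n. wmem s a = h a) \<and> (\<forall>a\<ge>N2 + 2 * n. wmem s a = 0) \<and> rmem s = g)"
  unfolding layout_code_def
proof (rule hoare_seq)
  let ?R = "\<lambda>s. pointers (wreg s) \<and>
        (\<forall>a<N2 + n. wmem s a = h a) \<and> (\<forall>a\<ge>N2 + n. wmem s a = 0) \<and> rmem s = g"
  show "hoare w (\<lambda>s. wreg s rN = n \<and> wreg s rSq = N2 \<and> wreg s rPerm = N2 + n \<and>
        (\<forall>a<N2 + n. wmem s a = h a) \<and> (\<forall>a\<ge>N2 + n. wmem s a = 0) \<and> rmem s = g)
     (block [WOp WAdd rBits rPerm rN, WOp WAdd rBuf rBits rN, WOp WAdd rVec rSq rSq]) 3 ?R"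
    using small by (intro hoare_block) (auto simp: eval_add pointers_def)
  show "hoare w ?R (for_loop rI rN (block [WOp WAdd rA rPerm rI, WStore rA rI])) (5 * n + 3)
     (\<lambda>s. pointers (wreg s) \<and> stored (wmem s) (N2 + n) [0..<n] \<and>
        (\<forall>a<N2 + n. wmem s a = h a) \<and> (\<forall>a\<ge>N2 + 2 * n. wmem s a = 0) \<and> rmem s = g)"
    by (rule hoare_for_block[where N = n and
        I = "\<lambda>i s. pointers (wreg s) \<and> stored (wmem s) (N2 + n) [0..<i] \<and>
          (\<forall>a<N2 + n. wmem s a = h a) \<and> (\<forall>a\<ge>N2 + n + i. wmem s a = 0) \<and> rmem s = g"])
      (use small in \<open>auto simp: eval_add pointers_def stored_snoc\<close>)
qed simp

definition scanning ::
  "(nat \<Rightarrow> nat) \<Rightarrow> (nat \<Rightarrow> real) \<Rightarrow> nat \<Rightarrow> nat \<Rightarrow> nat list \<Rightarrow> config \<Rightarrow> bool" where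
  "scanning h g t x bs s \<longleftrightarrow> pointers (wreg s) \<and> wreg s rT = t \<and> wreg s rX = x \<and>
     wreg s rQ = N2 + 3 * n + length bs \<and> (\<forall>a<N2 + 3 * n. wmem s a = h a) \<and> rmem s = g \<and>
     stored (wmem s) (N2 + 3 * n) bs"

text \<open>A row that is skipped leaves garbage behind the stored list, at the very place where the next row
  goes. The scanned permutation lies below the buffer and is therefore not affected.\<close>

lemma hoare_scan:
  assumes h: "\<forall>a<N2. h a = M a" "stored h (N2 + n) zs"
    and zs: "length zs = n" "set zs \<subseteq> {..<n}" and x: "x < n" and bs: "length bs \<le> n"
  shows "hoare w (scanning h g t x bs) (scan_code flip) (12 * n + 3)
     (scanning h g t x (bs @ filter (\<lambda>v. E v x \<noteq> flip) zs))"
  unfolding scan_code_def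
proof (rule hoare_for_block[where N = n and
    I = "\<lambda>i. scanning h g t x (bs @ filter (\<lambda>v. E v x \<noteq> flip) (take i zs))"])
  fix i s
  assume i: "i < n" and s: "scanning h g t x (bs @ filter (\<lambda>v. E v x \<noteq> flip) (take i zs)) s"
     "wreg s rI = i" "wreg s rN = n"
  let ?v = "zs ! i"
  have v: "?v < n" using subsetD[OF zs(2) nth_mem] zs(1) i by simp
  have len: "length (filter (\<lambda>v. E v x \<noteq> flip) (take i zs)) < n"
    using i zs length_filter_le[of "\<lambda>v. E v x \<noteq> flip" "take i zs"] by auto
  have perm: "wmem s (N2 + n + i) = ?v"
    using s(1) h(2) i zs n unfolding scanning_def stored_def by auto
  have bit: "wmem s (?v * n + x) = of_bool (E ?v x)"
    using s(1) h(1) M[OF v x] index_less[OF v x] unfolding scanning_def by simp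
  note bounds = index_less[OF v x] row_start_less[OF v] small n_le
  let ?is = "[WOp WAdd rA rPerm rI, WLoad rV rA, WOp WMul rB rV rN, WOp WAdd rB rB rX, WLoad rB rB,
       WStore rQ rV] @ (if flip then [WConst rA 1, WOp WSub rB rA rB] else []) @ [WOp WAdd rQ rQ rB]"
  show "wreg (fold (effect w) ?is s) rI = i \<and> wreg (fold (effect w) ?is s) rN = n \<and>
      scanning h g t x (bs @ filter (\<lambda>v. E v x \<noteq> flip) (take (Suc i) zs))
       ((fold (effect w) ?is s)\<lparr>wreg := (wreg (fold (effect w) ?is s))(1 := 1, rI := Suc i)\<rparr>)"
    using s bounds bit perm len bs i x zs
    by (cases "E ?v x"; cases flip)
      (auto simp: scanning_def pointers_def eval_add eval_mul eval_sub w_pos one_mod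
        take_Suc_conv_app_nth stored_other stored_snoc simp flip: append_assoc)
qed (use small zs in \<open>auto simp: scanning_def pointers_def\<close>)

lemma hoare_copy:
  assumes "length zs = n"
  shows "hoare w (\<lambda>s. pointers (wreg s) \<and> wreg s rT = t \<and> (\<forall>a<N2 + n. wmem s a = h a) \<and>
       rmem s = g \<and> stored (wmem s) (N2 + 3 * n) zs \<and> bits_clear s)
     copy_code (7 * n + 3)
     (\<lambda>s. pointers (wreg s) \<and> wreg s rT = t \<and> (\<forall>a<N2 + n. wmem s a = h a) \<and>
       rmem s = g \<and> stored (wmem s) (N2 + n) zs \<and> bits_clear s)"
  unfolding copy_code_def
proof (rule hoare_for_block[where N = n and
    I = "\<lambda>i s. pointers (wreg s) \<and> wreg s rT = t \<and> (\<forall>a<N2 + n. wmem s a = h a) \<and>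
       rmem s = g \<and> stored (wmem s) (N2 + 3 * n) zs \<and> stored (wmem s) (N2 + n) (take i zs) \<and>
       bits_clear s"])
  fix i s
  assume i: "i < n" and s: "pointers (wreg s) \<and> wreg s rT = t \<and> (\<forall>a<N2 + n. wmem s a = h a) \<and>
       rmem s = g \<and> stored (wmem s) (N2 + 3 * n) zs \<and> stored (wmem s) (N2 + n) (take i zs) \<and>
       bits_clear s" "wreg s rI = i" "wreg s rN = n"
  let ?is = "[WOp WAdd rA rBuf rI, WLoad rV rA, WOp WAdd rA rPerm rI, WStore rA rV]"
  have "wmem s (N2 + 3 * n + i) = zs ! i"
    using s i assms by (simp add: stored_def)
  then show "wreg (fold (effect w) ?is s) rI = i \<and> wreg (fold (effect w) ?is s) rN = n \<and>
     (\<lambda>s. pointers (wreg s) \<and> wreg s rT = t \<and> (\<forall>a<N2 + n. wmem s a = h a) \<and>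
       rmem s = g \<and> stored (wmem s) (N2 + 3 * n) zs \<and> stored (wmem s) (N2 + n) (take (Suc i) zs) \<and>
       bits_clear s)
       ((fold (effect w) ?is s)\<lparr>wreg := (wreg (fold (effect w) ?is s))(1 := 1, rI := Suc i)\<rparr>)"
    using s i assms small n_le
    by (auto simp: pointers_def eval_add take_Suc_conv_app_nth stored_other stored_snoc bits_clear_def)
qed (use small assms in \<open>auto simp: pointers_def bits_clear_def\<close>)

text \<open>After \<open>t\<close> rounds the permutation is sorted by the last \<open>t\<close> columns. The two scans of a round
  are the two halves of the recursion of \<open>radix_sort\<close>.\<close>

lemma hoare_sort:
  assumes h: "\<forall>a<N2. h a = M a" "stored h N2 xs"
    and xs: "length xs = n" "set xs \<subseteq> {..<n}"
  shows "hoare w (\<lambda>s. pointers (wreg s) \<and> (\<forall>a<N2 + n. wmem s a = h a) \<and>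
       rmem s = g \<and> stored (wmem s) (N2 + n) [0..<n] \<and> bits_clear s)
     sort_code (31 * n\<^sup>2 + 17 * n + 3)
     (\<lambda>s. pointers (wreg s) \<and> (\<forall>a<N2 + n. wmem s a = h a) \<and>
       rmem s = g \<and> stored (wmem s) (N2 + n) (radix_sort E xs [0..<n]) \<and> bits_clear s)"
  unfolding sort_code_def
proof -
  let ?inv = "\<lambda>t s. pointers (wreg s) \<and> (\<forall>a<N2 + n. wmem s a = h a) \<and> rmem s = g \<and>
       stored (wmem s) (N2 + n) (radix_sort E (drop (n - t) xs) [0..<n]) \<and> bits_clear s"
  let ?init = "block [WConst rOne 1, WOp WAdd rA rT rOne, WOp WSub rA rPerm rA, WLoad rX rA, WMove rQ rBuf]"
  let ?scans = "scan_code True ;; scan_code False ;; copy_code"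
  have round: "hoare w (\<lambda>s. ?inv t s \<and> wreg s rT = t \<and> wreg s rN = n) (?init ;; ?scans) (31 * n + 14)
     (\<lambda>s. wreg s rT = t \<and> wreg s rN = n \<and> ?inv (Suc t) (s\<lparr>wreg := (wreg s)(1 := 1, rT := Suc t)\<rparr>))"
    if t: "t < n" for t
  proof (rule hoare_snapshot)
    fix s0 :: config assume s0: "?inv t s0 \<and> wreg s0 rT = t \<and> wreg s0 rN = n"
    define zs where "zs = radix_sort E (drop (n - t) xs) [0..<n]"
    define x where "x = xs ! (n - Suc t)"
    define m where "m = wmem s0"
    have zs: "length zs = n" "set zs \<subseteq> {..<n}"
      by (auto simp: zs_def length_radix_sort set_radix_sort)
    have x: "x < n"
      using subsetD[OF xs(2) nth_mem, of "n - Suc t"] xs(1) t by (simp add: x_def)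
    have sorted: "radix_sort E (drop (n - Suc t) xs) [0..<n] =
        filter (\<lambda>v. E v x \<noteq> True) zs @ filter (\<lambda>v. E v x \<noteq> False) zs"
      using t xs by (simp add: zs_def x_def Suc_diff_Suc flip: Cons_nth_drop_Suc)
    have m: "\<forall>a<N2 + n. m a = h a" "\<forall>a<N2. m a = M a" "stored m (N2 + n) zs"
      "\<forall>j<n. m (N2 + 2 * n + j) = 0"
      using s0 h(1) unfolding m_def zs_def bits_clear_def by auto
    have "m (N2 + (n - Suc t)) = x"
      using m(1)[rule_format, of "N2 + (n - Suc t)"] t xs
        h(2)[unfolded stored_def, rule_format, of "n - Suc t"] by (simp add: x_def)
    then have x0: "m (N2 + n - Suc t) = x" using t by simp
    show "hoare w (\<lambda>s. s = s0) (?init ;; ?scans) (31 * n + 14)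
      (\<lambda>s. wreg s rT = t \<and> wreg s rN = n \<and> ?inv (Suc t) (s\<lparr>wreg := (wreg s)(1 := 1, rT := Suc t)\<rparr>))"
    proof (rule hoare_seq)
      show "hoare w (\<lambda>s. s = s0) ?init 5 (scanning m g t x [])"
        using s0 x0 small n_le t m_def
        by (intro hoare_block)
          (auto simp: scanning_def pointers_def eval_add eval_sub one_mod w_pos)
      show "hoare w (scanning m g t x []) ?scans (31 * n + 9)
        (\<lambda>s. wreg s rT = t \<and> wreg s rN = n \<and> ?inv (Suc t) (s\<lparr>wreg := (wreg s)(1 := 1, rT := Suc t)\<rparr>))"
      proof (rule hoare_seq[OF hoare_scan[OF m(2,3) zs x] hoare_seq[OF hoare_scan[OF m(2,3) zs x]
            hoare_conseq[OF hoare_copy[where h = h]]]])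
        fix s
        assume "scanning m g t x
          (([] @ filter (\<lambda>v. E v x \<noteq> True) zs) @ filter (\<lambda>v. E v x \<noteq> False) zs) s"
        then show "pointers (wreg s) \<and> wreg s rT = t \<and> (\<forall>a<N2 + n. wmem s a = h a) \<and>
          rmem s = g \<and> stored (wmem s) (N2 + 3 * n) (radix_sort E (drop (n - Suc t) xs) [0..<n]) \<and>
          bits_clear s"
          using m by (auto simp: scanning_def sorted bits_clear_def)
      qed (use zs length_filter_le[of _ zs] in
          \<open>auto simp: length_radix_sort pointers_def bits_clear_def\<close>)
    qed simp
  qed
  show "hoare w (\<lambda>s. pointers (wreg s) \<and> (\<forall>a<N2 + n. wmem s a = h a) \<and>
       rmem s = g \<and> stored (wmem s) (N2 + n) [0..<n] \<and> bits_clear s)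
     (for_loop rT rN (?init ;; ?scans)) (31 * n\<^sup>2 + 17 * n + 3)
     (\<lambda>s. pointers (wreg s) \<and> (\<forall>a<N2 + n. wmem s a = h a) \<and>
       rmem s = g \<and> stored (wmem s) (N2 + n) (radix_sort E xs [0..<n]) \<and> bits_clear s)"
    by (rule hoare_for[where N = n and T = "\<lambda>_. 31 * n + 14" and I = ?inv, OF _ _ _ _ _ round])
      (use small xs(1) in
        \<open>auto simp: pointers_def bits_clear_def power2_eq_square algebra_simps\<close>)
qed

text \<open>The state while one entry of the vector is processed: \<open>V\<close> is the product computed so far, the
  update loop runs \<open>cnt\<close> times, and \<open>g\<close> describes the input and result areas of real memory, which
  the loop leaves unchanged.\<close>

definition axpy_state ::
  "(nat \<Rightarrow> nat) \<Rightarrow> (nat \<Rightarrow> real) \<Rightarrow> nat \<Rightarrow> nat \<Rightarrow> nat \<Rightarrow> nat \<Rightarrow> real \<Rightarrow> (nat \<Rightarrow> real) \<Rightarrow> config \<Rightarrow> bool"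
  where
  "axpy_state m g t q j cnt d V s \<longleftrightarrow> pointers (wreg s) \<and> wreg s rT = t \<and> wreg s rQ = q \<and>
     wreg s rI = j \<and> wreg s rC = j * n \<and> wreg s rV = cnt \<and> rreg s 0 = d \<and> wmem s = m \<and>
     (\<forall>a<2 * N2. rmem s a = g a) \<and> (\<forall>k<n. rmem s (2 * N2 + k) = V k)"

lemma hoare_axpy:
  assumes j: "j < n" and cnt: "cnt \<le> n"
  shows "hoare w (axpy_state m g t q j cnt d V) axpy_code (10 * cnt + 3)
     (axpy_state m g t q j cnt d (\<lambda>k. V k + (if k < cnt then d * g (j * n + k) else 0)))"
  unfolding axpy_code_def
proof (rule hoare_for_block[where N = cnt and
    I = "\<lambda>i. axpy_state m g t q j cnt d (\<lambda>k. V k + (if k < i then d * g (j * n + k) else 0))"])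
  fix i s
  assume i: "i < cnt" and s: "axpy_state m g t q j cnt d (\<lambda>k. V k + (if k < i then d * g (j * n + k) else 0)) s"
     "wreg s rK = i" "wreg s rV = cnt"
  let ?is = "[WOp WAdd rA rC rK, RLoad 1 rA, ROp RMul 1 0 1,
      WOp WAdd rA rVec rK, RLoad 2 rA, ROp RAdd 2 2 1, RStore rA 2]"
  have idx: "j * n + i < N2" using index_less[OF j] i cnt by simp
  then have load: "rmem s (j * n + i) = g (j * n + i)" "rmem s (2 * N2 + i) = V i"
    using s(1) i cnt by (auto simp: axpy_state_def)
  show "wreg (fold (effect w) ?is s) rK = i \<and> wreg (fold (effect w) ?is s) rV = cnt \<and>
     axpy_state m g t q j cnt d (\<lambda>k. V k + (if k < Suc i then d * g (j * n + k) else 0))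
       ((fold (effect w) ?is s)\<lparr>wreg := (wreg (fold (effect w) ?is s))(1 := 1, rK := Suc i)\<rparr>)"
    using s i cnt idx load small n_le
    by (auto simp: axpy_state_def pointers_def eval_add)
qed (use small cnt n_le in \<open>auto simp: axpy_state_def pointers_def\<close>)

text \<open>The invariant of the update phase: the vector \<open>cur\<close> and its product with the real matrix are both
  in memory. Below their areas, memory is described by \<open>h\<close> and \<open>g\<close>.\<close>

definition row_state ::
  "(nat \<Rightarrow> nat) \<Rightarrow> (nat \<Rightarrow> real) \<Rightarrow> nat \<Rightarrow> nat \<Rightarrow> (nat \<Rightarrow> nat) \<Rightarrow> config \<Rightarrow> bool" where
  "row_state h g t q cur s \<longleftrightarrow> pointers (wreg s) \<and> wreg s rT = t \<and> wreg s rQ = q \<and>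
     (\<forall>a<N2 + 2 * n. wmem s a = h a) \<and> (\<forall>a<2 * N2. rmem s a = g a) \<and>
     (\<forall>j<n. wmem s (N2 + 2 * n + j) = cur j) \<and>
     (\<forall>k<n. rmem s (2 * N2 + k) = (\<Sum>j<n. real (cur j) * g (j * n + k)))"

lemma sum_fun_upd_weight:
  fixes f :: "nat \<Rightarrow> real" and cur :: "nat \<Rightarrow> nat"
  assumes "j < n"
  shows "(\<Sum>i<n. real ((cur(j := b)) i) * f i) = (\<Sum>i<n. real (cur i) * f i) + (real b - real (cur j)) * f j"
  using assms by (simp add: sum.remove[of _ j] algebra_simps)

text \<open>Changing one entry changes the product by a multiple of one row; if the entry does not change,
  then \<open>d = 0\<close> and the skipped update would have added nothing.\<close>

lemma hoare_entry:
  assumes j: "j < n" and v: "v < n" and h: "h (v * n + j) \<le> 1" and cur: "cur j \<le> 1"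
  shows "hoare w (\<lambda>s. row_state h g t (v * n) cur s \<and> wreg s rI = j) entry_code
     (16 + 10 * n * of_bool (h (v * n + j) \<noteq> cur j))
     (\<lambda>s. row_state h g t (v * n) (cur(j := h (v * n + j))) s \<and> wreg s rI = j)"
  unfolding entry_code_def
proof (rule hoare_snapshot, rule hoare_seq)
  fix s0 :: config assume s0: "row_state h g t (v * n) cur s0 \<and> wreg s0 rI = j"
  define b where "b = h (v * n + j)"
  define cnt where "cnt = n * of_bool (b \<noteq> cur j)"
  define d where "d = real b - real (cur j)"
  define V where "V = (\<lambda>k. \<Sum>j<n. real (cur j) * g (j * n + k))"
  let ?m = "(wmem s0)(N2 + 2 * n + j := b)"
  have cnt: "cnt \<le> n" by (simp add: cnt_def)
  have load: "wmem s0 (v * n + j) = b" "wmem s0 (N2 + 2 * n + j) = cur j"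
    using s0 index_less[OF v j] j by (auto simp: row_state_def b_def)
  have "(b + cur j) mod 2 = of_bool (b \<noteq> cur j)"
    using h cur by (cases b; cases "cur j") (auto simp: b_def[symmetric])
  then have mod: "(b + cur j) mod 2 * n = cnt" by (simp add: cnt_def)
  have le: "b + cur j \<le> 2" using h cur by (simp add: b_def)
  show "hoare w (\<lambda>s. s = s0)
     (block [WOp WAdd rA rQ rI, WLoad rV rA, WOp WAdd rB rBits rI, WLoad rC rB, WStore rB rV,
       RFromWord 0 rV, RFromWord 1 rC, ROp RSub 0 0 1,
       WOp WAdd rV rV rC, WConst rB 2, WOp WMod rV rV rB, WOp WMul rV rV rN, WOp WMul rC rI rN]) 13
     (axpy_state ?m g t (v * n) j cnt d V)"
    using s0 load mod le cnt small n_le j index_less[OF v j] row_start_less[OF j] row_start_less[OF v]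
    by (intro hoare_block)
      (auto simp: row_state_def axpy_state_def pointers_def eval_add eval_mul eval_mod2 two_mod V_def d_def)
  show "hoare w (axpy_state ?m g t (v * n) j cnt d V) axpy_code (10 * cnt + 3)
     (\<lambda>s. row_state h g t (v * n) (cur(j := h (v * n + j))) s \<and> wreg s rI = j)"
  proof (rule hoare_conseq[OF hoare_axpy[OF j cnt]])
    fix s
    assume s: "axpy_state ?m g t (v * n) j cnt d (\<lambda>k. V k + (if k < cnt then d * g (j * n + k) else 0)) s"
    have "V k + (if k < cnt then d * g (j * n + k) else 0) =
        (\<Sum>i<n. real ((cur(j := b)) i) * g (i * n + k))" if "k < n" for k
      unfolding V_def using that by (subst sum_fun_upd_weight[OF j]) (auto simp: d_def cnt_def)
    then show "row_state h g t (v * n) (cur(j := h (v * n + j))) s \<and> wreg s rI = j"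
      using s s0 unfolding axpy_state_def row_state_def b_def[symmetric] by auto
  qed auto
qed auto

lemma row_disjoint: "u \<noteq> v \<Longrightarrow> k < n \<Longrightarrow> u * n + k < v * n \<or> v * n + n \<le> u * n + (k :: nat)"
proof -
  assume "u \<noteq> v" "k < n"
  then consider "Suc u \<le> v" | "Suc v \<le> u" by linarith
  then show ?thesis
    using mult_le_mono1[of "Suc u" v n] mult_le_mono1[of "Suc v" u n] \<open>k < n\<close>
    by cases auto
qed

text \<open>Real memory after the first \<open>i\<close> entries of \<open>S\<close> have been copied to row \<open>v\<close> of the result.\<close>

definition put_row :: "nat \<Rightarrow> (nat \<Rightarrow> real) \<Rightarrow> nat \<Rightarrow> (nat \<Rightarrow> real) \<Rightarrow> nat \<Rightarrow> real" where
  "put_row v S i g a = (if N2 + v * n \<le> a \<and> a < N2 + v * n + i then S (a - (N2 + v * n)) else g a)"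

lemma put_row_0: "put_row v S 0 g = g"
  by (auto simp: put_row_def)

lemma put_row_Suc: "put_row v S (Suc i) g = (put_row v S i g)(N2 + v * n + i := S i)"
  by (auto simp: put_row_def)

lemma put_row_less: "a < N2 \<Longrightarrow> put_row v S i g a = g a"
  by (simp add: put_row_def)

lemma hoare_store_row:
  assumes v: "v < n"
  defines "S \<equiv> \<lambda>g cur k. \<Sum>j<n. real (cur j) * g (j * n + k)"
  shows "hoare w (row_state h g t (v * n) cur) store_row_code (8 * n + 3)
     (row_state h (put_row v (S g cur) n g) t (v * n) cur)"
  unfolding store_row_code_def
proof (rule hoare_for_block[where N = n and
    I = "\<lambda>i. row_state h (put_row v (S g cur) i g) t (v * n) cur"])
  fix i s
  assume i: "i < n" and s: "row_state h (put_row v (S g cur) i g) t (v * n) cur s"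
     "wreg s rI = i" "wreg s rN = n"
  let ?is = "[WOp WAdd rA rVec rI, RLoad 1 rA, WOp WAdd rA rSq rQ, WOp WAdd rA rA rI, RStore rA 1]"
  have vec: "(\<Sum>j<n. real (cur j) * put_row v (S g cur) i' g (j * n + k)) = S g cur k"
    if "k < n" for i' k
    unfolding S_def using that index_less by (intro sum.cong) (auto simp: put_row_less)
  define g1 where "g1 = put_row v (S g cur) i g"
  define g2 where "g2 = put_row v (S g cur) (Suc i) g"
  have vec: "\<forall>k<n. (\<Sum>j<n. real (cur j) * g1 (j * n + k)) = S g cur k"
    "\<forall>k<n. (\<Sum>j<n. real (cur j) * g2 (j * n + k)) = S g cur k"
    using vec by (simp_all add: g1_def g2_def)
  have put: "g2 (N2 + v * n + i) = S g cur i" "\<forall>a. a \<noteq> N2 + v * n + i \<longrightarrow> g2 a = g1 a"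
    by (simp_all add: put_row_Suc g1_def g2_def)
  show "wreg (fold (effect w) ?is s) rI = i \<and> wreg (fold (effect w) ?is s) rN = n \<and>
     row_state h (put_row v (S g cur) (Suc i) g) t (v * n) cur
       ((fold (effect w) ?is s)\<lparr>wreg := (wreg (fold (effect w) ?is s))(1 := 1, rI := Suc i)\<rparr>)"
    using s i index_less[OF v i] row_start_less[OF v] small n_le put vec
    unfolding g1_def[symmetric] g2_def[symmetric]
    by (auto simp: row_state_def pointers_def eval_add)
qed (use small in \<open>auto simp: row_state_def pointers_def put_row_0\<close>)

text \<open>The vector at the beginning of step \<open>i\<close>: the preceding row in sorted order, or zero at the
  start, so that the first row needs no separate treatment.\<close>

definition last_bits :: "nat list \<Rightarrow> nat \<Rightarrow> nat \<Rightarrow> nat" where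
  "last_bits ys i j = (if i = 0 then 0 else of_bool (E (ys ! (i - 1)) j))"

definition changed_bits :: "nat list \<Rightarrow> nat \<Rightarrow> nat" where
  "changed_bits ys i = (\<Sum>j<n. of_bool (of_bool (E (ys ! i) j) \<noteq> last_bits ys i j))"

text \<open>The only term beyond \<open>O(n\<^sup>2)\<close> in the running time is \<open>n\<close> per changed bit.\<close>

lemma hoare_rows:
  fixes P :: "nat \<Rightarrow> real"
  assumes ys: "length ys = n" "set ys = {..<n}"
  defines "R \<equiv> \<lambda>v k. \<Sum>j<n. of_bool (E v j) * P (j * n + k)"
  shows "hoare w
     (\<lambda>s. pointers (wreg s) \<and> (\<forall>a<N2. wmem s a = M a) \<and> stored (wmem s) (N2 + n) ys \<and>
       bits_clear s \<and> (\<forall>a<N2. rmem s a = P a) \<and> (\<forall>a\<ge>N2. rmem s a = 0))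
     rows_code (27 * n\<^sup>2 + 12 * n + 3 + 10 * n * (\<Sum>i<n. changed_bits ys i))
     (\<lambda>s. pointers (wreg s) \<and> (\<forall>u<n. \<forall>k<n. rmem s (N2 + (u * n + k)) = R u k))"
  unfolding rows_code_def
proof -
  let ?S = "\<lambda>g cur k. \<Sum>j<n. real (cur j) * g (j * n + k)"
  let ?inv = "\<lambda>i s. pointers (wreg s) \<and> (\<forall>a<N2. wmem s a = M a) \<and> stored (wmem s) (N2 + n) ys \<and>
    (\<forall>j<n. wmem s (N2 + 2 * n + j) = last_bits ys i j) \<and> (\<forall>a<N2. rmem s a = P a) \<and>
    (\<forall>k<n. rmem s (2 * N2 + k) = ?S P (last_bits ys i) k) \<and>
    (\<forall>u\<in>set (take i ys). \<forall>k<n. rmem s (N2 + (u * n + k)) = R u k)"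
  let ?load = "block [WOp WAdd rA rPerm rT, WLoad rX rA, WOp WMul rQ rX rN]"
  let ?T = "\<lambda>i. 27 * n + 10 * n * changed_bits ys i + 9"
  have body: "hoare w (\<lambda>s. ?inv i s \<and> wreg s rT = i \<and> wreg s rN = n)
      (?load ;; for_loop rI rN entry_code ;; store_row_code) (?T i)
      (\<lambda>s. wreg s rT = i \<and> wreg s rN = n \<and> ?inv (Suc i) (s\<lparr>wreg := (wreg s)(1 := 1, rT := Suc i)\<rparr>))"
    if i: "i < n" for i
  proof (rule hoare_snapshot)
    fix s0 :: config assume s0: "?inv i s0 \<and> wreg s0 rT = i \<and> wreg s0 rN = n"
    define v where "v = ys ! i"
    define h where "h = wmem s0"
    define g where "g = rmem s0"
    define cur where "cur = last_bits ys i"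
    have v: "v < n" using nth_mem[of i ys] i unfolding v_def ys by simp
    have row: "h (v * n + j) = of_bool (E v j)" if "j < n" for j
      using s0 M[OF v that] index_less[OF v that] by (simp add: h_def)
    have perm: "wmem s0 (N2 + n + i) = v"
      using s0 ys(1) i by (simp add: stored_def v_def)
    have sum_g: "?S g c k = ?S P c k" if "k < n" for c k
      using s0 that index_less by (intro sum.cong) (auto simp: g_def)
    show "hoare w (\<lambda>s. s = s0) (?load ;; for_loop rI rN entry_code ;; store_row_code) (?T i)
      (\<lambda>s. wreg s rT = i \<and> wreg s rN = n \<and> ?inv (Suc i) (s\<lparr>wreg := (wreg s)(1 := 1, rT := Suc i)\<rparr>))"
    proof (rule hoare_seq)
      show "hoare w (\<lambda>s. s = s0) ?load 3 (row_state h g i (v * n) cur)"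
        using s0 perm i small n_le row_start_less[OF v] sum_g
        by (intro hoare_block)
          (auto simp: row_state_def pointers_def eval_add eval_mul h_def g_def cur_def)
      let ?cur = "\<lambda>j' j. if j < j' then h (v * n + j) else cur j"
      have entry: "hoare w (\<lambda>s. row_state h g i (v * n) (?cur j') s \<and> wreg s rI = j' \<and> wreg s rN = n)
          entry_code (16 + 10 * n * of_bool (of_bool (E v j') \<noteq> cur j'))
          (\<lambda>s. wreg s rI = j' \<and> wreg s rN = n \<and>
            row_state h g i (v * n) (?cur (Suc j')) (s\<lparr>wreg := (wreg s)(1 := 1, rI := Suc j')\<rparr>))"
        if j': "j' < n" for j'
      proof (rule hoare_conseq[OF hoare_entry[OF j' v, where cur = "?cur j'"]])
        show "h (v * n + j') \<le> 1" using row[OF j'] by simp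
        show "?cur j' j' \<le> 1" by (simp add: cur_def last_bits_def)
        fix s
        have upd: "(?cur j')(j' := h (v * n + j')) = ?cur (Suc j')" by auto
        assume "row_state h g i (v * n) ((?cur j')(j' := h (v * n + j'))) s \<and> wreg s rI = j'"
        then show "wreg s rI = j' \<and> wreg s rN = n \<and>
            row_state h g i (v * n) (?cur (Suc j')) (s\<lparr>wreg := (wreg s)(1 := 1, rI := Suc j')\<rparr>)"
          unfolding upd by (auto simp: row_state_def pointers_def)
      qed (auto simp: row[OF j'])
      have entries: "hoare w (row_state h g i (v * n) cur) (for_loop rI rN entry_code)
          (19 * n + 10 * n * changed_bits ys i + 3) (row_state h g i (v * n) (?cur n))"
        by (rule hoare_for[where N = n and I = "\<lambda>j'. row_state h g i (v * n) (?cur j')", OF _ _ _ _ _ entry])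
          (use small in \<open>auto simp: row_state_def pointers_def changed_bits_def cur_def v_def
             sum.distrib sum_distrib_left\<close>)
      show "hoare w (row_state h g i (v * n) cur) (for_loop rI rN entry_code ;; store_row_code)
          (27 * n + 10 * n * changed_bits ys i + 6)
          (\<lambda>s. wreg s rT = i \<and> wreg s rN = n \<and>
            ?inv (Suc i) (s\<lparr>wreg := (wreg s)(1 := 1, rT := Suc i)\<rparr>))"
      proof (rule hoare_seq[OF entries hoare_conseq[OF hoare_store_row[OF v]]])
        fix s
        assume s: "row_state h (put_row v (?S g (?cur n)) n g) i (v * n) (?cur n) s"
        have cur: "?cur n j = of_bool (E v j)" "last_bits ys (Suc i) j = of_bool (E v j)" if "j < n" for j
          using row that by (auto simp: last_bits_def v_def)
        have SR: "?S g (?cur n) k = R v k" if "k < n" for k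
          unfolding sum_g[OF that] R_def using cur(1) by (intro sum.cong) auto
        have SP: "?S (put_row v (?S g (?cur n)) n g) (?cur n) k = ?S P (last_bits ys (Suc i)) k" if "k < n" for k
          using that index_less cur s0 by (intro sum.cong) (auto simp: put_row_less g_def)
        have res: "rmem s (N2 + (u * n + k)) = R u k" if u: "u \<in> set (take (Suc i) ys)" and k: "k < n" for u k
        proof -
          have "u < n" using u in_set_takeD ys(2) by fastforce
          then have eq: "rmem s (N2 + (u * n + k)) = put_row v (?S g (?cur n)) n g (N2 + (u * n + k))"
            using s index_less[OF _ k] unfolding row_state_def by simp
          show ?thesis
          proof (cases "u = v")
            case True
            then show ?thesis unfolding eq using k SR by (simp add: put_row_def)
          next
            case False
            then have "u \<in> set (take i ys)"
              using u i ys(1) by (auto simp: take_Suc_conv_app_nth v_def)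
            then show ?thesis
              unfolding eq using row_disjoint[OF False k] s0 k by (auto simp: put_row_def g_def)
          qed
        qed
        show "wreg s rT = i \<and> wreg s rN = n \<and> ?inv (Suc i) (s\<lparr>wreg := (wreg s)(1 := 1, rT := Suc i)\<rparr>)"
          using s s0 res SP cur ys(1) i
          unfolding row_state_def
          by (auto simp: pointers_def put_row_less h_def g_def stored_def simp del: take_Suc)
      qed auto
    qed simp
  qed
  show "hoare w
     (\<lambda>s. pointers (wreg s) \<and> (\<forall>a<N2. wmem s a = M a) \<and> stored (wmem s) (N2 + n) ys \<and>
       bits_clear s \<and> (\<forall>a<N2. rmem s a = P a) \<and> (\<forall>a\<ge>N2. rmem s a = 0))
     (for_loop rT rN (?load ;; for_loop rI rN entry_code ;; store_row_code))
     (27 * n\<^sup>2 + 12 * n + 3 + 10 * n * (\<Sum>i<n. changed_bits ys i))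
     (\<lambda>s. pointers (wreg s) \<and> (\<forall>u<n. \<forall>k<n. rmem s (N2 + (u * n + k)) = R u k))"
    by (rule hoare_for[where N = n and I = ?inv, OF _ _ _ _ _ body])
      (use small ys in \<open>auto simp: pointers_def bits_clear_def last_bits_def sum.distrib
         sum_distrib_left[symmetric] power2_eq_square algebra_simps\<close>)
qed

text \<open>The result cannot be written over the input before all rows are complete, since each row of the
  product depends on the whole input.\<close>

lemma hoare_output:
  "hoare w (\<lambda>s. pointers (wreg s) \<and> (\<forall>a<N2. rmem s (N2 + a) = G a))
     output_code (6 * N2 + 3) (\<lambda>s. \<forall>a<N2. rmem s a = G a)"
  unfolding output_code_def
  by (rule hoare_for_block[where N = N2 and I = "\<lambda>i s. pointers (wreg s) \<and>
        (\<forall>a<N2. rmem s (N2 + a) = G a) \<and> (\<forall>a<i. rmem s a = G a)"])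
    (use small in \<open>auto simp: pointers_def eval_add less_Suc_eq\<close>)

end


section \<open>Sampling and the final guarantee\<close>

text \<open>This code is placed at address \<open>0\<close>. It needs no initial test: the sampling loop is entered with
  at least one column to draw. Everything random happens here; the rest of the program is
  deterministic.\<close>

definition sample_code :: "instr list" where
  "sample_code =
     [WOp WMul rSq rN rN, WConst rOne 1, WMove 3 rSq, WOp WAdd rPerm rSq rN,
      Random 5 rN, WStore 3 5, WOp WAdd 3 3 rOne, JumpWLess 3 rPerm 4]"

definition product_code :: code where
  "product_code = layout_code ;; sort_code ;; rows_code ;; output_code"

definition product_program :: program where
  "product_program = sample_code @ product_code (length sample_code)"

lemma run_4:
  "run w prog 4 s = bind_pmf (step w prog s) (\<lambda>s. bind_pmf (step w prog s) (\<lambda>s.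
     bind_pmf (step w prog s) (step w prog)))"
proof -
  have "run w prog (Suc t) = (\<lambda>s. bind_pmf (step w prog s) (run w prog t))" for t
    by (simp add: fun_eq_iff)
  moreover have "run w prog 0 = return_pmf"
    by (simp add: fun_eq_iff)
  ultimately show ?thesis
    by (simp add: numeral_eq_Suc bind_return_pmf')
qed

context product_machine
begin

text \<open>The configuration reached after the columns \<open>xs\<close> have been drawn; it is given in full, so that
  the distribution of configurations is the image of the distribution of \<open>xs\<close>.\<close>

definition sampled :: "(nat \<Rightarrow> real) \<Rightarrow> nat list \<Rightarrow> config" where
  "sampled P xs =
     \<lparr>pc = if length xs < n then 4 else 8,
      wreg = (\<lambda>_. 0)(rN := n, rOne := 1, rSq := N2, 3 := N2 + length xs, rPerm := N2 + n,
        5 := if xs = [] then 0 else last xs),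
      rreg = (\<lambda>_. 0),
      wmem = (\<lambda>a. if N2 \<le> a \<and> a < N2 + length xs then xs ! (a - N2) else M a),
      rmem = P\<rparr>"

lemma run_init:
  "run w product_program 4
     \<lparr>pc = 0, wreg = (\<lambda>_. 0)(0 := n), rreg = (\<lambda>_. 0), wmem = M, rmem = P\<rparr> =
   return_pmf (sampled P [])"
  using n small
  by (simp add: run_4 step_def halted_def product_program_def sample_code_def
      bind_return_pmf set_wreg_def sampled_def eval_add eval_mul w_pos flip: numeral_2_eq_2 N2)
    (auto simp: fun_eq_iff)

lemma run_draw:
  assumes "length xs < n"
  shows "run w product_program 4 (sampled P xs) =
    map_pmf (\<lambda>x. sampled P (xs @ [x])) (pmf_of_set {..<n})"
proof -
  have w: "N2 + length xs + 1 < 2 ^ w"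
    using assms small by simp
  show ?thesis
    using assms n w
    by (simp add: run_4 step_def halted_def product_program_def sample_code_def
        bind_return_pmf set_wreg_def cond_jump_def sampled_def eval_add map_pmf_def bind_assoc_pmf)
      (auto intro!: bind_pmf_cong simp: fun_eq_iff nth_append)
qed

lemma run_draws:
  "length xs + m \<le> n \<Longrightarrow> run w product_program (4 * m) (sampled P xs) =
    map_pmf (\<lambda>ys. sampled P (xs @ ys)) (replicate_pmf m (pmf_of_set {..<n}))"
proof (induction m arbitrary: xs)
  case (Suc m)
  have "run w product_program (4 * Suc m) (sampled P xs) =
      run w product_program (4 + 4 * m) (sampled P xs)"
    by simp
  also have "\<dots> = bind_pmf (pmf_of_set {..<n}) (\<lambda>x. run w product_program (4 * m) (sampled P (xs @ [x])))"
    unfolding run_add using Suc.prems by (subst run_draw) (auto simp: bind_map_pmf)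
  also have "\<dots> = map_pmf (\<lambda>ys. sampled P (xs @ ys)) (replicate_pmf (Suc m) (pmf_of_set {..<n}))"
    using Suc.prems by (simp add: Suc.IH map_bind_pmf map_pmf_def bind_assoc_pmf bind_return_pmf)
  finally show ?case .
qed simp

text \<open>The coefficient \<open>64\<close> is \<open>31\<close> for sorting, \<open>27\<close> for the update phase without the changed bits,
  and \<open>6\<close> for copying back. Correctness does not depend on the sample, only the time does.\<close>

lemma run_product_code:
  assumes xs: "length xs = n" "set xs \<subseteq> {..<n}"
    and M0: "\<And>a. a \<ge> N2 \<Longrightarrow> M a = 0" and P0: "\<And>a. a \<ge> N2 \<Longrightarrow> P a = 0"
    and T: "64 * n\<^sup>2 + 34 * n + 15 +
      10 * n * (\<Sum>i<n. changed_bits (radix_sort E xs [0..<n]) i) \<le> T"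
  shows "\<exists>s. run w product_program T (sampled P xs) = return_pmf s \<and> halted product_program s \<and>
    (\<forall>u<n. \<forall>k<n. rmem s (u * n + k) = (\<Sum>j<n. of_bool (E u j) * P (j * n + k)))"
proof -
  let ?ys = "radix_sort E xs [0..<n]"
  let ?R = "\<lambda>u k. \<Sum>j<n. of_bool (E u j) * P (j * n + k)"
  define h where "h = wmem (sampled P xs)"
  have h: "\<forall>a<N2. h a = M a" "stored h N2 xs" "\<forall>a\<ge>N2 + n. h a = 0"
    using xs M0 by (auto simp: h_def sampled_def stored_def)
  have ys: "length ?ys = n" "set ?ys = {..<n}"
    by (auto simp: length_radix_sort set_radix_sort)
  have out: "hoare w (\<lambda>s. pointers (wreg s) \<and> (\<forall>u<n. \<forall>k<n. rmem s (N2 + (u * n + k)) = ?R u k))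
     output_code (6 * N2 + 3) (\<lambda>s. \<forall>u<n. \<forall>k<n. rmem s (u * n + k) = ?R u k)"
  proof (rule hoare_snapshot)
    fix s0 :: config
    assume s0: "pointers (wreg s0) \<and> (\<forall>u<n. \<forall>k<n. rmem s0 (N2 + (u * n + k)) = ?R u k)"
    show "hoare w (\<lambda>s. s = s0) output_code (6 * N2 + 3) (\<lambda>s. \<forall>u<n. \<forall>k<n. rmem s (u * n + k) = ?R u k)"
      by (rule hoare_conseq[OF hoare_output[where G = "\<lambda>a. rmem s0 (N2 + a)"]])
        (use s0 index_less in auto)
  qed
  have "hoare w (\<lambda>s. s = sampled P xs) product_code T (\<lambda>s. \<forall>u<n. \<forall>k<n. rmem s (u * n + k) = ?R u k)"
    unfolding product_code_def
  proof (rule hoare_seq[OF _ hoare_seq[OF _ hoare_seq[OF hoare_rows[OF ys] out order_refl] order_refl]])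
    show "hoare w (\<lambda>s. s = sampled P xs) layout_code (5 * n + 6)
     (\<lambda>s. pointers (wreg s) \<and> (\<forall>a<N2 + n. wmem s a = h a) \<and> rmem s = P \<and>
       stored (wmem s) (N2 + n) [0..<n] \<and> bits_clear s)"
      by (rule hoare_conseq[OF hoare_layout[where h = h and g = P]])
        (use h in \<open>auto simp: h_def sampled_def bits_clear_def\<close>)
    show "hoare w (\<lambda>s. pointers (wreg s) \<and> (\<forall>a<N2 + n. wmem s a = h a) \<and> rmem s = P \<and>
       stored (wmem s) (N2 + n) [0..<n] \<and> bits_clear s) sort_code (31 * n\<^sup>2 + 17 * n + 3)
     (\<lambda>s. pointers (wreg s) \<and> (\<forall>a<N2. wmem s a = M a) \<and> stored (wmem s) (N2 + n) ?ys \<and>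
       bits_clear s \<and> (\<forall>a<N2. rmem s a = P a) \<and> (\<forall>a\<ge>N2. rmem s a = 0))"
      by (rule hoare_conseq[OF hoare_sort[OF h(1,2) xs]]) (use h P0 in auto)
    show "5 * n + 6 + (31 * n\<^sup>2 + 17 * n + 3 + (27 * n\<^sup>2 + 12 * n + 3 +
        10 * n * sum (changed_bits ?ys) {..<n} + (6 * N2 + 3))) \<le> T"
      using T by (simp add: N2 power2_eq_square)
  qed
  then obtain t s where ts: "t \<le> T" "computes w product_code (sampled P xs) t s"
    "\<forall>u<n. \<forall>k<n. rmem s (u * n + k) = ?R u k"
    unfolding hoare_def by blast
  let ?s = "s\<lparr>pc := length product_program\<rparr>"
  have pc: "(sampled P xs)\<lparr>pc := length sample_code\<rparr> = sampled P xs"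
    using xs by (simp add: sampled_def sample_code_def)
  have "run w product_program t (sampled P xs) = return_pmf ?s"
    using ts(2)[unfolded computes_def, rule_format, of sample_code "[]"]
    unfolding pc by (simp add: product_program_def)
  moreover have halt: "halted product_program ?s" by (simp add: halted_def)
  ultimately have "run w product_program (t + (T - t)) (sampled P xs) = return_pmf ?s"
    by (metis run_trans run_halted)
  then show ?thesis using ts halt by (intro exI[of _ ?s]) auto
qed

text \<open>The first row is compared with the zero vector, every other row with its predecessor.\<close>

lemma sum_changed_bits:
  "(\<Sum>i<n. changed_bits ys i) \<le> n + (\<Sum>i<n - 1. hamming E n (ys ! i) (ys ! Suc i))"
proof -
  have "changed_bits ys 0 \<le> (\<Sum>j<n. 1)"
    unfolding changed_bits_def by (intro sum_mono) auto
  moreover have "changed_bits ys (Suc i) = hamming E n (ys ! i) (ys ! Suc i)" for i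
    unfolding changed_bits_def hamming_def last_bits_def
    by (auto simp: of_bool_def sum.If_cases Int_def intro!: arg_cong[of _ _ card])
  moreover have "(\<Sum>i<n. changed_bits ys i) = changed_bits ys 0 + (\<Sum>i<n - 1. changed_bits ys (Suc i))"
    using n sum.lessThan_Suc_shift[of "changed_bits ys" "n - 1"] by simp
  ultimately show ?thesis by simp
qed

end

text \<open>Separates the two halves of the analysis: probability theory for the draws, and a verification of
  the deterministic remainder for each good outcome \<open>x\<close>.\<close>

lemma prob_bind_pmf_ge:
  assumes "\<And>x. x \<in> set_pmf D \<Longrightarrow> x \<in> G \<Longrightarrow> \<exists>y\<in>S. K x = return_pmf y"
  shows "measure_pmf.prob (bind_pmf D K) S \<ge> measure_pmf.prob D G"
proof -
  have "emeasure D G = (\<integral>\<^sup>+x. indicator G x \<partial>D)" by simp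
  also have "\<dots> \<le> (\<integral>\<^sup>+x. emeasure (K x) S \<partial>D)"
  proof (intro nn_integral_mono_AE, unfold AE_measure_pmf_iff, intro ballI)
    fix x assume "x \<in> set_pmf D"
    then show "indicator G x \<le> emeasure (K x) S"
      using assms[of x] by (cases "x \<in> G") auto
  qed
  also have "\<dots> = emeasure (bind_pmf D K) S" by simp
  finally show ?thesis by (simp add: measure_pmf.emeasure_eq_measure)
qed

lemma row_major_index:
  "A \<in> carrier_mat n n \<Longrightarrow> i < n \<Longrightarrow> j < n \<Longrightarrow> row_major A (i * n + j) = A $$ (i, j)"
proof -
  assume A: "A \<in> carrier_mat n n" and ij: "i < n" "j < n"
  then have "i * n + j < Suc i * n" by simp
  also have "\<dots> \<le> n * n" using ij by (intro mult_le_mono1) simp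
  finally show ?thesis using A ij by (auto simp: row_major_def)
qed

text \<open>Words of \<open>4 * floorlog 2 n\<close> bits represent all numbers below \<open>(n + 1) ^ 4\<close>, more than
  the memory in use.\<close>

lemma product_machine_word_length:
  assumes "n \<ge> 1"
  shows "product_machine n (word_length 4 n) (n * n) E (row_major (adjacency_matrix n E))"
proof
  have "n + 1 \<le> 2 ^ floorlog 2 n" using floorlog_bounds[of n 2] assms by simp
  then have "(n + 1) ^ 4 \<le> (2 ^ floorlog 2 n) ^ 4" by (intro power_mono) auto
  then have "(n + 1) ^ 4 \<le> 2 ^ word_length 4 n"
    by (simp add: word_length_def mult.commute flip: power_mult)
  moreover have "3 * (n * n) + 4 * n + 3 < (n + 1) ^ 4"
  proof -
    have "1 \<le> n * n" "1 \<le> n * (n * n)" using assms by simp_all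
    moreover have "(n + 1) ^ 4 = n * (n * (n * n)) + 4 * (n * (n * n)) + 6 * (n * n) + 4 * n + 1"
      by (simp add: eval_nat_numeral algebra_simps)
    ultimately show ?thesis by linarith
  qed
  ultimately show "3 * (n * n) + 4 * n + 3 < 2 ^ word_length 4 n" by linarith
  show "row_major (adjacency_matrix n E) (v * n + x) = (of_bool (E v x) :: nat)" if "v < n" "x < n" for v x
    using that by (subst row_major_index) (auto simp: adjacency_matrix_def)
qed (use assms in auto)

text \<open>The cost of sorting, updating and copying back, with the path length of the sorted rows inserted.
  It is a bound for separating samples; the other samples are the failure event.\<close>

definition time_bound :: "real \<Rightarrow> nat \<Rightarrow> nat" where
  "time_bound c n = nat \<lceil>64 * real n ^ 2 + 34 * real n + 15 + 10 * real n * (real n + (c * real n +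
     4 * real n * ln (real n) * (c * (1 + ln (real n)) + 1)))\<rceil>"

lemma prob_product_program:
  assumes "c > 0" and n: "n \<ge> 1" and lin: "linear_nbhd_complexity c {..<n} E"
    and P: "P \<in> carrier_mat n n"
  shows "measure_pmf.prob
      (run (word_length 4 n) product_program (4 + (4 * n + time_bound c n))
        (init_config n (adjacency_matrix n E) P))
      {s. halted product_program s \<and> output_matrix n s = adjacency_matrix n E * P} \<ge> 1 - 1 / real n"
proof -
  let ?M = "row_major (adjacency_matrix n E :: nat mat)"
  let ?S = "{s. halted product_program s \<and> output_matrix n s = adjacency_matrix n E * P}"
  let ?D = "replicate_pmf n (pmf_of_set {..<n})"
  interpret product_machine n "word_length 4 n" "n * n" E ?M
    by (rule product_machine_word_length[OF n])
  let ?run = "\<lambda>xs. run (word_length 4 n) product_program (time_bound c n) (sampled (row_major P) xs)"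
  have "run (word_length 4 n) product_program (4 + (4 * n + time_bound c n))
        (init_config n (adjacency_matrix n E) P) = bind_pmf ?D ?run"
    unfolding init_config_def
    by (subst run_trans[OF run_init refl]) (simp add: run_add run_draws bind_map_pmf)
  moreover have "measure_pmf.prob ?D {xs. separating E n xs} \<le> measure_pmf.prob (bind_pmf ?D ?run) ?S"
  proof (rule prob_bind_pmf_ge)
    fix xs assume "xs \<in> set_pmf ?D" and sep: "xs \<in> {xs. separating E n xs}"
    moreover have "{..<n} \<noteq> {}" using n by (auto simp: lessThan_empty_iff)
    ultimately have xs: "length xs = n" "set xs \<subseteq> {..<n}"
      by (auto simp: set_replicate_pmf)
    let ?ys = "radix_sort E xs [0..<n]"
    have "real (\<Sum>i<n. changed_bits ?ys i) \<le>
        real n + (c * real n + 4 * real n * ln (real n) * (c * (1 + ln (real n)) + 1))"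
      using of_nat_mono[OF sum_changed_bits[of ?ys], where 'a = real]
        path_length_radix_sort[OF lin \<open>c > 0\<close> n xs(2,1)] sep by simp
    then have "10 * real n * real (\<Sum>i<n. changed_bits ?ys i) \<le> 10 * real n *
        (real n + (c * real n + 4 * real n * ln (real n) * (c * (1 + ln (real n)) + 1)))"
      by (intro mult_left_mono) auto
    then have "real (64 * n\<^sup>2 + 34 * n + 15 + 10 * n * (\<Sum>i<n. changed_bits ?ys i)) \<le> real (time_bound c n)"
      unfolding time_bound_def by (intro order_trans[OF _ real_nat_ceiling_ge]) simp
    then have T: "64 * n\<^sup>2 + 34 * n + 15 + 10 * n * (\<Sum>i<n. changed_bits ?ys i) \<le> time_bound c n"
      by (simp only: of_nat_le_iff)
    have zero: "?M a = 0" "row_major P a = 0" if "a \<ge> n * n" for a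
      using that P by (auto simp: row_major_def adjacency_matrix_def)
    obtain s where s: "?run xs = return_pmf s" "halted product_program s"
      "\<And>u k. u < n \<Longrightarrow> k < n \<Longrightarrow>
         rmem s (u * n + k) = (\<Sum>j<n. of_bool (E u j) * row_major P (j * n + k))"
      using run_product_code[where P = "row_major P", OF xs zero(1) zero(2) T] by blast
    have "output_matrix n s = adjacency_matrix n E * P"
    proof (rule eq_matI)
      fix i j assume "i < dim_row (adjacency_matrix n E * P)" "j < dim_col (adjacency_matrix n E * P)"
      then have ij: "i < n" "j < n" using P by (auto simp: adjacency_matrix_def)
      have "output_matrix n s $$ (i, j) = (\<Sum>k<n. of_bool (E i k) * P $$ (k, j))"
        using ij P by (auto simp: output_matrix_def s(3) row_major_index intro!: sum.cong)
      also have "\<dots> = (\<Sum>k<n. adjacency_matrix n E $$ (i, k) * P $$ (k, j))"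
        using ij by (intro sum.cong) (auto simp: adjacency_matrix_def)
      also have "\<dots> = (adjacency_matrix n E * P) $$ (i, j)"
        using ij P by (simp add: scalar_prod_def atLeast0LessThan adjacency_matrix_def)
      finally show "output_matrix n s $$ (i, j) = (adjacency_matrix n E * P) $$ (i, j)" .
    qed (use P in \<open>auto simp: output_matrix_def adjacency_matrix_def\<close>)
    then show "\<exists>s\<in>?S. ?run xs = return_pmf s" using s by auto
  qed
  ultimately show ?thesis using prob_separating[OF n, of E] by simp
qed

lemma time_bound_bigo:
  assumes "c > 0"
  shows "(\<lambda>n. real (4 + (4 * n + time_bound c n))) \<in> O(\<lambda>n. real n ^ 2 * ln (real n) ^ 2)"
proof -
  let ?B = "\<lambda>n. 64 * real n ^ 2 + 34 * real n + 15 + 10 * real n * (real n + (c * real n +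
     4 * real n * ln (real n) * (c * (1 + ln (real n)) + 1)))"
  have le: "real (time_bound c n) \<le> ?B n + 1" for n
  proof -
    have "?B n \<ge> 0" using assms by (cases "n = 0") (auto intro!: add_nonneg_nonneg mult_nonneg_nonneg)
    then show ?thesis unfolding time_bound_def by linarith
  qed
  have "(\<lambda>n. real (4 + (4 * n + time_bound c n))) \<in> O(\<lambda>n. 4 + (4 * real n + (?B n + 1)))"
  proof (intro landau_o.big_mono always_eventually allI)
    fix n
    have "real (4 + (4 * n + time_bound c n)) \<le> 4 + (4 * real n + (?B n + 1))"
      using le[of n] by simp
    then show "norm (real (4 + (4 * n + time_bound c n))) \<le> norm (4 + (4 * real n + (?B n + 1)))"
      unfolding real_norm_def abs_of_nat by (rule order_trans[OF _ abs_ge_self])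
  qed
  also have "(\<lambda>n. 4 + (4 * real n + (?B n + 1))) \<in> O(\<lambda>n. real n ^ 2 * ln (real n) ^ 2)"
    using assms by real_asymp
  finally show ?thesis .
qed

theorem theorem16:
  fixes c :: real
  assumes "c > 0"
  shows "\<exists>(prog :: program) (k :: nat) (T :: nat \<Rightarrow> nat) (p :: nat \<Rightarrow> real).
    k > 0 \<and>
    (\<lambda>n. real (T n)) \<in> O(\<lambda>n. real n ^ 2 * ln (real n) ^ 2) \<and>
    p \<longlonglongrightarrow> 1 \<and>
    (\<forall>(n :: nat) (E :: nat \<Rightarrow> nat \<Rightarrow> bool) (P :: real mat).
       simple_graph {..<n} E \<longrightarrow>
       linear_nbhd_complexity c {..<n} E \<longrightarrow>
       P \<in> carrier_mat n n \<longrightarrow>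
       measure_pmf.prob
         (run (word_length k n) prog (T n) (init_config n (adjacency_matrix n E) P))
         {s. halted prog s \<and> output_matrix n s = adjacency_matrix n E * P} \<ge> p n)"
proof (intro exI conjI allI impI)
  \<comment> \<open>The sampling loop presupposes a non-empty matrix, so nothing is claimed for \<open>n = 0\<close>.\<close>
  let ?p = "\<lambda>n. if n = 0 then 0 else 1 - 1 / real n"
  show "(0 :: nat) < 4" by simp
  show "(\<lambda>n. real (4 + (4 * n + time_bound c n))) \<in> O(\<lambda>n. real n ^ 2 * ln (real n) ^ 2)"
    using assms by (rule time_bound_bigo)
  have "(\<lambda>n. 1 - 1 / real n) \<longlonglongrightarrow> 1" by real_asymp
  then show "?p \<longlonglongrightarrow> 1"
    by (rule Lim_transform_eventually) (auto intro: eventually_mono[OF eventually_gt_at_top[of 0]])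
  fix n :: nat and E :: "nat \<Rightarrow> nat \<Rightarrow> bool" and P :: "real mat"
  assume "linear_nbhd_complexity c {..<n} E" "P \<in> carrier_mat n n"
  then show "?p n \<le> measure_pmf.prob
         (run (word_length 4 n) product_program (4 + (4 * n + time_bound c n)) (init_config n (adjacency_matrix n E) P))
         {s. halted product_program s \<and> output_matrix n s = adjacency_matrix n E * P}"
    using prob_product_program[OF assms] by (cases "n = 0") auto
qed

end
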